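(* Let $\psi = \varphi_w$ with $w \in \{a,b,\alpha,\beta\}^*$. If at least three distinct letters of $\{a,b,\alpha,\beta\}$ occur in $w$, then $\psi$ is not closeable under derivation.
   Context: Morphisms on $\{0,1\}^*$: $\varphi_a: 0\mapsto 0, 1 \mapsto 10$; $\varphi_b: 0 \mapsto 0, 1\mapsto 01$; $\varphi_\alpha: 0\mapsto 01, 1\mapsto 1$; $\varphi_\beta: 0\mapsto 10, 1 \mapsto 1$; for $w=w_0\cdots w_{m-1}$, $\varphi_w = \varphi_{w_0}\circ\cdots\circ\varphi_{w_{m-1}}$ (this is primitive iff $w$ contains a letter from $\{a,b\}$ and one from $\{\alpha,\beta\}$). A morphism $\psi$ is primitive if some power $\psi^k$ has every letter occurring in every $\psi^k(c)$. A substitution is a morphism $\psi$ with a letter $c$ such that $\psi(c) = cx$ for a nonempty word $x$ and $|\psi^n(c)|\to\infty$. Derived word: for a uniformly recurrent word $\mathbf{u}$ and a factor $v$, a return word of $v$ is a factor $r$ such that $rv$ is a factor in which $v$ occurs exactly twice (as prefix and as suffix); if $r_0,\dots,r_k$ are all return words, write $\mathbf{u} = p\,r_{s_0}r_{s_1}\cdots$ with $|p|$ the first occurrence of $v$; then $\mathbf{d}_{\mathbf{u}}(v) = s_0s_1s_2\cdots$, considered up to permutation of letters. A finite set $M$ of primitive substitutions is closed under derivation if for every $\varphi\in M$, every fixed point $\mathbf{u}$ of $\varphi$ and every factor $v$ of $\mathbf{u}$, the derived word $\mathbf{d}_{\mathbf{u}}(v)$ is fixed by some primitive substitution $\psi \in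 M$. A primitive substitution is closeable under derivation if it belongs to some finite set closed under derivation. *)

theory Defs
  imports Main "HOL-Library.Infinite_Set"
begin

text \<open>Letters are natural numbers; a substitution is given by a size n of its
alphabet {0..<n} and a map psi :: nat => nat list (values outside the alphabet are
irrelevant). Infinite words are functions nat => nat. The binary alphabet is {0,1}.\<close>

definition morph :: "(nat \<Rightarrow> nat list) \<Rightarrow> nat list \<Rightarrow> nat list" where
  "morph \<psi> x = concat (map \<psi> x)"

definition iter_morph :: "(nat \<Rightarrow> nat list) \<Rightarrow> nat \<Rightarrow> nat list \<Rightarrow> nat list" where
  "iter_morph \<psi> k = (morph \<psi>) ^^ k"

definition primitive_morph :: "nat \<Rightarrow> (nat \<Rightarrow> nat list) \<Rightarrow> bool" where
  "primitive_morph n \<psi> \<longleftrightarrow>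
     (\<forall>c<n. set (\<psi> c) \<subseteq> {0..<n}) \<and>
     (\<exists>k>0. \<forall>c<n. \<forall>d<n. d \<in> set (iter_morph \<psi> k [c]))"

definition is_substitution :: "nat \<Rightarrow> (nat \<Rightarrow> nat list) \<Rightarrow> bool" where
  "is_substitution n \<psi> \<longleftrightarrow>
     (\<forall>c<n. set (\<psi> c) \<subseteq> {0..<n}) \<and>
     (\<exists>c<n. \<exists>x. x \<noteq> [] \<and> \<psi> c = c # x \<and>
        filterlim (\<lambda>m. length (iter_morph \<psi> m [c])) at_top at_top)"

definition primitive_substitution :: "nat \<Rightarrow> (nat \<Rightarrow> nat list) \<Rightarrow> bool" where
  "primitive_substitution n \<psi> \<longleftrightarrow> primitive_morph n \<psi> \<and> is_substitution n \<psi>"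

definition pref :: "(nat \<Rightarrow> nat) \<Rightarrow> nat \<Rightarrow> nat list" where
  "pref u N = map u [0..<N]"

definition subw :: "(nat \<Rightarrow> nat) \<Rightarrow> nat \<Rightarrow> nat \<Rightarrow> nat list" where
  "subw u i m = map u [i..<i+m]"

text \<open>u is a fixed point of psi (over the alphabet {0..<n}): psi(u) = u.
 For a non-erasing psi this is equivalent to psi mapping every prefix of u to a prefix of u.\<close>
definition fixed_point :: "nat \<Rightarrow> (nat \<Rightarrow> nat list) \<Rightarrow> (nat \<Rightarrow> nat) \<Rightarrow> bool" where
  "fixed_point n \<psi> u \<longleftrightarrow> (\<forall>i. u i < n) \<and>
     (\<forall>N. morph \<psi> (pref u N) = pref u (length (morph \<psi> (pref u N))))"

definition factor :: "nat list \<Rightarrow> (nat \<Rightarrow> nat) \<Rightarrow> bool" where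
  "factor v u \<longleftrightarrow> (\<exists>i. subw u i (length v) = v)"

definition occs_fin :: "nat list \<Rightarrow> nat list \<Rightarrow> nat set" where
  "occs_fin v x = {i. i + length v \<le> length x \<and> take (length v) (drop i x) = v}"

definition return_words :: "(nat \<Rightarrow> nat) \<Rightarrow> nat list \<Rightarrow> nat list set" where
  "return_words u v = {r. r \<noteq> [] \<and> factor (r @ v) u \<and> occs_fin v (r @ v) = {0, length r}}"

definition occs :: "(nat \<Rightarrow> nat) \<Rightarrow> nat list \<Rightarrow> nat set" where
  "occs u v = {i. subw u i (length v) = v}"

definition occ_pos :: "(nat \<Rightarrow> nat) \<Rightarrow> nat list \<Rightarrow> nat \<Rightarrow> nat" where
  "occ_pos u v k = enumerate (occs u v) k"

text \<open>The k-th return word in the decomposition u = p r_{s_0} r_{s_1} ...,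
 where |p| is the first occurrence of v.\<close>
definition ret_seq :: "(nat \<Rightarrow> nat) \<Rightarrow> nat list \<Rightarrow> nat \<Rightarrow> nat list" where
  "ret_seq u v k = subw u (occ_pos u v k) (occ_pos u v (Suc k) - occ_pos u v k)"

text \<open>The derived word d_u(v) is the coding of ret_seq by letters, taken up to a
 renaming (injective relabelling) of the return words; so "d_u(v) is fixed by psi"
 means: for some injective coding f of the return words, (f o ret_seq u v) is fixed by psi.\<close>
definition derived_word_fixed_by :: "(nat \<Rightarrow> nat) \<Rightarrow> nat list \<Rightarrow> nat \<Rightarrow> (nat \<Rightarrow> nat list) \<Rightarrow> bool" where
  "derived_word_fixed_by u v m \<chi> \<longleftrightarrow>
     (\<exists>f :: nat list \<Rightarrow> nat. inj_on f (return_words u v) \<and>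
        fixed_point m \<chi> (\<lambda>k. f (ret_seq u v k)))"

definition closed_under_derivation :: "(nat \<times> (nat \<Rightarrow> nat list)) set \<Rightarrow> bool" where
  "closed_under_derivation M \<longleftrightarrow> finite M \<and>
     (\<forall>(n, \<psi>) \<in> M. primitive_substitution n \<psi>) \<and>
     (\<forall>(n, \<psi>) \<in> M. \<forall>u. fixed_point n \<psi> u \<longrightarrow>
        (\<forall>v. factor v u \<longrightarrow> (\<exists>(m, \<chi>) \<in> M. derived_word_fixed_by u v m \<chi>)))"

definition closeable_under_derivation :: "nat \<Rightarrow> (nat \<Rightarrow> nat list) \<Rightarrow> bool" where
  "closeable_under_derivation n \<psi> \<longleftrightarrow>
     primitive_substitution n \<psi> \<and> (\<exists>M. closed_under_derivation M \<and> (n, \<psi>) \<in> M)"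

datatype gen = Ga | Gb | Galpha | Gbeta

fun phi_gen :: "gen \<Rightarrow> nat \<Rightarrow> nat list" where
  "phi_gen Ga c = (if c = 0 then [0] else if c = 1 then [1,0] else [c])"
| "phi_gen Gb c = (if c = 0 then [0] else if c = 1 then [0,1] else [c])"
| "phi_gen Galpha c = (if c = 0 then [0,1] else if c = 1 then [1] else [c])"
| "phi_gen Gbeta c = (if c = 0 then [1,0] else if c = 1 then [1] else [c])"

fun phi :: "gen list \<Rightarrow> nat \<Rightarrow> nat list" where
  "phi [] c = [c]"
| "phi (g # w) c = morph (phi_gen g) (phi w c)"

end

theory Submission
  imports Defs Complex_Main "HOL-Library.Sublist"
begin

text \<open>
  Let \<open>u\<close> be a fixed point of \<open>\<phi>\<^sub>w\<close>. Deriving repeatedly with respect to a single letter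
  replaces \<open>u\<close> by shifts of its successive desubstitutions, and one step reads
  \<open>x = p \<phi>\<^sub>g(x')\<close> with \<open>|p| \<le> 1\<close> and \<open>g \<in> {b, \<beta>}\<close>. The elements of a finite closed set have only
  finitely many fixed points, so after some full passes through \<open>w\<close> one meets a word \<open>x\<close> with
  \<open>x = p \<sigma>(x)\<close>, where \<open>\<sigma>\<close> is a product of \<open>\<phi>\<^sub>b\<close> and \<open>\<phi>\<^sub>\<beta>\<close>, and also \<open>x = \<psi>(x)\<close> for some growing \<open>\<psi>\<close>.

  These two equations force \<open>p\<close> to be empty. The incidence matrices of \<open>\<sigma>\<close> and \<open>\<psi>\<close> commute since
  both have the same irrational contracting eigenvector, so \<open>\<sigma>\<psi>\<close> and \<open>\<psi>\<sigma>\<close> have images of equal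
  lengths. If \<open>p\<close> were nonempty, then comparing \<open>x = p \<sigma>\<psi>(x)\<close> with \<open>x = \<psi>(p) \<psi>\<sigma>(x)\<close> would produce
  arbitrarily long common suffixes of \<open>\<psi>(h0)\<close> and \<open>\<psi>(h'1)\<close>, hence \<open>\<psi>(01) = \<psi>(10)\<close>,
  which is impossible.

  With \<open>p\<close> empty, the prefix of \<open>u\<close> that is cut off is reproduced after passing through \<open>w\<close>.
  Counting its letters leaves only the cases where \<open>w\<close> is a word over one of \<open>{a, \<alpha>}\<close>, \<open>{b, \<beta>}\<close>,
  \<open>{b, \<alpha>}\<close>, \<open>{a, \<beta>}\<close>.
\<close>

section \<open>Prefixes and affine images of infinite words\<close>

lemma morph_Nil [simp]: "morph \<psi> [] = []"
  and morph_Cons [simp]: "morph \<psi> (c # v) = \<psi> c @ morph \<psi> v"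
  and morph_append [simp]: "morph \<psi> (v @ w) = morph \<psi> v @ morph \<psi> w"
  by (simp_all add: morph_def)

lemma morph_morph: "morph \<psi> (morph \<chi> v) = morph (\<lambda>c. morph \<psi> (\<chi> c)) v"
  by (induction v) auto

lemma length_morph_ge:
  "(\<And>c. c \<in> set v \<Longrightarrow> k \<le> length (\<psi> c)) \<Longrightarrow> k * length v \<le> length (morph \<psi> v)"
  by (induction v) (auto simp: add_mono)

lemma set_morph: "set (morph \<psi> v) = (\<Union>c\<in>set v. set (\<psi> c))"
  by (simp add: morph_def)

lemma length_pref [simp]: "length (pref u N) = N"
  by (simp add: pref_def)

lemma nth_pref [simp]: "i < N \<Longrightarrow> pref u N ! i = u i"
  by (simp add: pref_def)

lemma pref_0 [simp]: "pref u 0 = []"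
  by (simp add: pref_def)

lemma pref_Suc: "pref u (Suc N) = pref u N @ [u N]"
  by (simp add: pref_def)

lemma take_pref: "take k (pref u N) = pref u (min k N)"
  by (simp add: pref_def take_map min_def)

lemma set_pref: "set (pref u N) = u ` {..<N}"
  by (auto simp: pref_def)

definition shift :: "nat \<Rightarrow> (nat \<Rightarrow> nat) \<Rightarrow> nat \<Rightarrow> nat" where
  "shift i u = (\<lambda>k. u (i + k))"

lemma shift_apply [simp]: "shift i u k = u (i + k)"
  by (simp add: shift_def)

lemma pref_add: "pref u (i + N) = pref u i @ pref (shift i u) N"
  by (induction N) (simp_all add: pref_Suc)

definition starts_with :: "(nat \<Rightarrow> nat) \<Rightarrow> nat list \<Rightarrow> bool" where
  "starts_with x v \<longleftrightarrow> v = pref x (length v)"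

lemma starts_with_pref [simp]: "starts_with x (pref x N)"
  by (simp add: starts_with_def)

lemma starts_with_appendD: "starts_with x (v @ w) \<Longrightarrow> starts_with x v"
  unfolding starts_with_def by (metis append_eq_conv_conj length_append le_add1 min_absorb1 take_pref)

lemma starts_with_extend:
  assumes "starts_with x v" "starts_with x w" "length v \<le> length w"
  shows "w = v @ drop (length v) w"
  using assms unfolding starts_with_def
  by (metis append_take_drop_id min_absorb1 take_pref)

lemma starts_with_eq:
  "starts_with x v \<Longrightarrow> starts_with x w \<Longrightarrow> length v = length w \<Longrightarrow> v = w"
  by (simp add: starts_with_def)

lemma starts_with_append_iff:
  "starts_with x (v @ w) \<longleftrightarrow> starts_with x v \<and> starts_with (shift (length v) x) w"
  unfolding starts_with_def by (auto simp: pref_add)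

lemma starts_with_nth: "starts_with x v \<Longrightarrow> i < length v \<Longrightarrow> x i = v ! i"
  unfolding starts_with_def by (metis nth_pref)

lemma starts_with_snoc: "starts_with x (v @ [x (length v)]) \<longleftrightarrow> starts_with x v"
  by (auto simp: starts_with_def pref_Suc)

text \<open>\<open>affine_image p \<psi> y x\<close> says \<open>x = p \<psi>(y)\<close>, provided \<open>\<psi>\<close> is non-erasing.\<close>

definition affine_image ::
    "nat list \<Rightarrow> (nat \<Rightarrow> nat list) \<Rightarrow> (nat \<Rightarrow> nat) \<Rightarrow> (nat \<Rightarrow> nat) \<Rightarrow> bool" where
  "affine_image p \<psi> y x \<longleftrightarrow> (\<forall>v. starts_with y v \<longrightarrow> starts_with x (p @ morph \<psi> v))"

lemma affine_imageD: "affine_image p \<psi> y x \<Longrightarrow> starts_with y v \<Longrightarrow> starts_with x (p @ morph \<psi> v)"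
  by (simp add: affine_image_def)

lemma affine_image_iff_pref:
  "affine_image p \<psi> y x \<longleftrightarrow> (\<forall>N. starts_with x (p @ morph \<psi> (pref y N)))"
  unfolding affine_image_def by (metis starts_with_def starts_with_pref)

lemma fixed_point_iff: "fixed_point n \<psi> u \<longleftrightarrow> (\<forall>i. u i < n) \<and> affine_image [] \<psi> u u"
  unfolding fixed_point_def affine_image_iff_pref starts_with_def by simp

lemma affine_image_comp:
  assumes "affine_image p \<psi> y x" "affine_image q \<chi> z y"
  shows "affine_image (p @ morph \<psi> q) (\<lambda>c. morph \<psi> (\<chi> c)) z x"
  using assms unfolding affine_image_def
  by (metis append_assoc morph_append morph_morph)

lemma affine_image_iter: "affine_image [] \<psi> u u \<Longrightarrow> affine_image [] (\<lambda>c. iter_morph \<psi> k [c]) u u"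
proof (induction k)
  case 0
  have "morph (\<lambda>c. [c]) v = v" for v by (induction v) auto
  then show ?case by (simp add: affine_image_def iter_morph_def)
next
  case (Suc k)
  then show ?case using affine_image_comp[of "[]" \<psi> u u "[]"] by (simp add: iter_morph_def)
qed

lemma affine_image_letter:
  assumes "affine_image p \<psi> y x"
  shows "starts_with (shift (length p + length (morph \<psi> (pref y k))) x) (\<psi> (y k))"
proof -
  have "starts_with x ((p @ morph \<psi> (pref y k)) @ \<psi> (y k))"
    using affine_imageD[OF assms starts_with_pref[of y "Suc k"]] by (simp add: pref_Suc)
  then show ?thesis unfolding starts_with_append_iff by simp
qed

section \<open>Standard morphisms\<close>

text \<open>\<open>phi_gen Ga\<close> is conjugate to \<open>phi_gen Gb\<close>, and
  \<open>phi_gen Galpha\<close> to \<open>phi_gen Gbeta\<close>. Under the chosen representatives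
  the image of a letter c ends in c, while the images of 0 and 1 start with the same letter.\<close>

fun standard :: "gen \<Rightarrow> gen" where
  "standard Ga = Gb" | "standard Gb = Gb" | "standard Galpha = Gbeta" | "standard Gbeta = Gbeta"

lemma phi_append: "phi (w1 @ w2) c = morph (phi w1) (phi w2 c)"
proof (induction w1)
  case Nil
  have "morph (\<lambda>c. [c]) v = v" for v by (induction v) auto
  then show ?case by (simp add: phi.simps(1)[abs_def])
qed (simp add: morph_morph)

lemma set_phi_gen: "c < 2 \<Longrightarrow> set (phi_gen g c) \<subseteq> {..<2}"
  by (cases g) auto

lemma set_morph_binary:
  "(\<And>c. c < 2 \<Longrightarrow> set (\<psi> c) \<subseteq> {..<2}) \<Longrightarrow> set v \<subseteq> {..<2} \<Longrightarrow> set (morph \<psi> v) \<subseteq> {..<(2 :: nat)}"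
  by (induction v) auto

lemma set_phi: "c < 2 \<Longrightarrow> set (phi w c) \<subseteq> {..<2}"
proof (induction w)
  case (Cons g w)
  then show ?case using set_morph_binary[OF set_phi_gen] by simp
qed auto

lemma length_binary: "set (v :: nat list) \<subseteq> {..<2} \<Longrightarrow> length v = count_list v 0 + count_list v 1"
  by (induction v) (auto simp: less_2_cases_iff)

lemma count_morph:
  "set v \<subseteq> {..<2} \<Longrightarrow> count_list (morph \<psi> v) d =
     count_list v 0 * count_list (\<psi> 0) d + count_list v 1 * count_list (\<psi> 1) d"
  by (induction v) (auto simp: less_2_cases_iff)

text \<open>Prepending \<open>Gb\<close> or \<open>Gbeta\<close> adds one row of the incidence
  matrix to the other. This preserves the determinant, lowers no entry and makes one off-diagonal
  entry positive.\<close>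

lemma count_phi_standard:
  assumes "set z \<subseteq> {Gb, Gbeta}"
  defines "m \<equiv> \<lambda>d c. count_list (phi z c) d"
  shows "m 0 0 * m 1 1 = m 0 1 * m 1 0 + 1" "1 \<le> m 0 0" "1 \<le> m 1 1"
    "Gb \<in> set z \<Longrightarrow> 1 \<le> m 0 1" "Gbeta \<in> set z \<Longrightarrow> 1 \<le> m 1 0"
proof -
  have "m 0 0 * m 1 1 = m 0 1 * m 1 0 + 1 \<and> 1 \<le> m 0 0 \<and> 1 \<le> m 1 1 \<and>
    (Gb \<in> set z \<longrightarrow> 1 \<le> m 0 1) \<and> (Gbeta \<in> set z \<longrightarrow> 1 \<le> m 1 0)"
    using assms(1) unfolding m_def
  proof (induction z)
    case (Cons g z)
    have "count_list (phi (g # z) c) d = count_list (phi z c) 0 * count_list (phi_gen g 0) d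
        + count_list (phi z c) 1 * count_list (phi_gen g 1) d" if "c < 2" for c d
      using count_morph[OF set_phi[OF that]] by simp
    then show ?case using Cons by (auto simp: algebra_simps)
  qed auto
  then show "m 0 0 * m 1 1 = m 0 1 * m 1 0 + 1" "1 \<le> m 0 0" "1 \<le> m 1 1"
    "Gb \<in> set z \<Longrightarrow> 1 \<le> m 0 1" "Gbeta \<in> set z \<Longrightarrow> 1 \<le> m 1 0" by blast+
qed

lemma phi_standard_ends:
  "set z \<subseteq> {Gb, Gbeta} \<Longrightarrow> c < 2 \<Longrightarrow> \<exists>v. phi z c = v @ [c]"
proof (induction z)
  case (Cons g z)
  then obtain v where "phi z c = v @ [c]" by auto
  moreover have "\<exists>v. phi_gen g c = v @ [c]" using Cons.prems by (auto simp: less_2_cases_iff)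
  ultimately show ?case by auto
qed auto

text \<open>Nonempty binary words have images starting with 0 under \<open>phi_gen Gb\<close> and
  with 1 under \<open>phi_gen Gbeta\<close>, so the outermost generator alone decides.\<close>

lemma phi_standard_first:
  assumes "set z \<subseteq> {Gb, Gbeta}" "z \<noteq> []"
  shows "\<exists>r. \<forall>c<2. \<exists>v. phi z c = r # v"
proof -
  obtain g z' where z: "z = g # z'" using assms by (cases z) auto
  have "\<exists>v. phi z c = (if g = Gb then 0 else 1) # v" if "c < 2" for c
  proof -
    have "phi z' c \<noteq> []" using phi_standard_ends[of z' c] assms that z by auto
    then obtain e v where "phi z' c = e # v" by (cases "phi z' c") auto
    moreover from this have "e < 2" using set_phi[OF that, of z'] by auto
    ultimately show ?thesis using assms z by (auto simp: less_2_cases_iff)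
  qed
  then show ?thesis by blast
qed

lemma length_phi_standard:
  assumes "set z = {Gb, Gbeta}" "c < 2"
  shows "2 \<le> length (phi z c)"
proof -
  have "length (phi z c) = count_list (phi z c) 0 + count_list (phi z c) 1"
    using length_binary set_phi assms by blast
  moreover have "set z \<subseteq> {Gb, Gbeta}" "Gb \<in> set z" "Gbeta \<in> set z" using assms by auto
  note count_phi_standard(2-5)[OF this(1)] this(2,3)
  ultimately show ?thesis using assms(2) by (force simp: less_2_cases_iff)
qed

section \<open>Weights given by a contracting eigenvector\<close>

text \<open>The characteristic polynomial is X^2 - tX + 1 with trace t at least 3, so its smaller
  root l lies in (0,1) and is irrational. The row vector (-\<kappa>, 1) is a left eigenvector for l,
  and \<kappa> is irrational along with l.\<close>

lemma contracting_eigenvector: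
  fixes m00 m01 m10 m11 :: nat
  assumes det: "m00 * m11 = m01 * m10 + 1" and pos: "1 \<le> m01" "1 \<le> m10" "1 \<le> m00" "1 \<le> m11"
  obtains \<kappa> l :: real where "\<kappa> > 0" "0 < l" "l < 1"
    "real m10 - \<kappa> * m00 = - l * \<kappa>" "real m11 - \<kappa> * m01 = l"
    "\<And>e f :: int. of_int e - \<kappa> * of_int f = 0 \<Longrightarrow> e = 0 \<and> f = 0"
proof -
  define t where "t = m00 + m11"
  have "1 < m00 * m11" using det pos by simp
  then have "\<not> (m00 = 1 \<and> m11 = 1)" by auto
  then have t: "3 \<le> t" using pos t_def by linarith
  define s where "s = sqrt (real t ^ 2 - 4)"
  have t3: "real t \<ge> 3" using t by simp
  have "3 * 3 \<le> real t * real t" using t3 by (intro mult_mono) auto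
  then have s2: "s ^ 2 = real t ^ 2 - 4" unfolding s_def by (simp add: power2_eq_square)
  have s0: "0 \<le> s" using s2 \<open>3 * 3 \<le> real t * real t\<close> unfolding s_def by (simp add: power2_eq_square)
  have "s < t" using s2 t3 by (intro power2_less_imp_less[of s "real t"]) auto
  have "real t - 2 < s"
    using s2 t3 s0 by (intro power2_less_imp_less[of "real t - 2" s]) (auto simp: power2_eq_square algebra_simps)
  define l where "l = (real t - s) / 2"
  have l: "0 < l" "l < 1" using \<open>s < t\<close> \<open>real t - 2 < s\<close> by (auto simp: l_def)
  have leq: "l ^ 2 + 1 = t * l" using s2 by (simp add: l_def power2_eq_square field_simps)
  define \<kappa> where "\<kappa> = (m11 - l) / m01"
  have kpos: "\<kappa> > 0" using l pos by (simp add: \<kappa>_def)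
  have k1: "real m11 - \<kappa> * m01 = l" using pos by (simp add: \<kappa>_def)
  have detr: "real m00 * m11 = real m01 * m10 + 1" using det by (metis of_nat_1 of_nat_add of_nat_mult)
  have "real m01 * (m10 - \<kappa> * m00 + l * \<kappa>) = real m01 * m10 - (\<kappa> * m01) * (m00 - l)"
    by (simp add: algebra_simps)
  also have "\<dots> = real m01 * m10 - (m11 - l) * (m00 - l)" using k1 by simp
  also have "\<dots> = 0" using detr leq by (simp add: t_def power2_eq_square algebra_simps)
  finally have k2: "real m10 - \<kappa> * m00 = - l * \<kappa>" using pos by auto
  have lirr: "l \<notin> \<rat>"
  proof
    assume "l \<in> \<rat>"
    then obtain m n :: nat where mn: "n \<noteq> 0" "\<bar>l\<bar> = m / n" "coprime m n"
      by (rule Rats_abs_nat_div_natE)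
    then have "real m = l * n" using l by simp
    then have "real m ^ 2 + real n ^ 2 = (l ^ 2 + 1) * real n ^ 2" by (simp add: power2_eq_square algebra_simps)
    also have "\<dots> = real t * real m * real n" using leq \<open>real m = l * n\<close> by (simp add: power2_eq_square)
    finally have "real (m ^ 2 + n ^ 2) = real (t * m * n)" by simp
    then have eq: "m ^ 2 + n ^ 2 = t * m * n" using of_nat_eq_iff by blast
    \<comment> \<open>By the equation m and n divide each other's squares; being coprime, both are
      1, which would give t = 2.\<close>
    have "m dvd t * m * n" "n dvd t * m * n" by simp_all
    then have "m dvd m ^ 2 + n ^ 2" "n dvd m ^ 2 + n ^ 2" using eq by simp_all
    then have "m dvd n ^ 2" "n dvd m ^ 2"
      by (simp_all add: power2_eq_square dvd_add_right_iff dvd_add_left_iff)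
    then have "m = 1" "n = 1" using mn(3)
      by (metis coprime_dvd_mult_left_iff coprime_commute power2_eq_square nat_dvd_1_iff_1
          mult_1 coprime_absorb_left is_unit_gcd_iff gcd_nat.absorb1 coprime_power_right_iff)+
    then show False using eq t by simp
  qed
  have "e = 0 \<and> f = 0" if "of_int e - \<kappa> * of_int f = 0" for e f :: int
  proof -
    have "f = 0"
    proof (rule ccontr)
      assume "f \<noteq> 0"
      then have "\<kappa> = of_int e / of_int f" using that by (simp add: field_simps)
      then have "\<kappa> \<in> \<rat>" by simp
      then have "l \<in> \<rat>" using k1 by (metis Rats_diff Rats_mult Rats_of_nat)
      then show False using lirr by simp
    qed
    then show ?thesis using that by simp
  qed
  then show ?thesis using that[OF kpos l k2 k1] by blast
qed

text \<open>The pairing of the row vector (-\<kappa>, 1) with the vector of letter counts.\<close>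

definition wt :: "real \<Rightarrow> nat list \<Rightarrow> real" where
  "wt \<kappa> v = real (count_list v 1) - \<kappa> * real (count_list v 0)"

lemma wt_Nil [simp]: "wt \<kappa> [] = 0"
  and wt_append [simp]: "wt \<kappa> (v @ w) = wt \<kappa> v + wt \<kappa> w"
  by (simp_all add: wt_def algebra_simps)

lemma wt_morph:
  "set v \<subseteq> {..<2} \<Longrightarrow> wt \<kappa> (morph \<psi> v) =
     real (count_list v 0) * wt \<kappa> (\<psi> 0) + real (count_list v 1) * wt \<kappa> (\<psi> 1)"
  by (simp add: wt_def count_morph algebra_simps)

lemma abs_wt_le:
  assumes "\<kappa> > 0"
  shows "\<bar>wt \<kappa> v\<bar> \<le> (1 + \<kappa>) * real (length v)"
proof -
  have c: "real (count_list v d) \<le> real (length v)" for d by (simp add: count_le_length)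
  have "\<kappa> * real (count_list v 0) \<le> \<kappa> * real (length v)" using assms c by (simp add: mult_left_mono)
  moreover have "0 \<le> \<kappa> * real (count_list v 0)" using assms by simp
  moreover have "(1 + \<kappa>) * real (length v) = real (length v) + \<kappa> * real (length v)"
    by (simp add: algebra_simps)
  ultimately show ?thesis using c[of 1] unfolding wt_def by linarith
qed

lemma set_starts_with: "starts_with x v \<Longrightarrow> (\<And>i. x i < n) \<Longrightarrow> set v \<subseteq> {..<n}"
  unfolding starts_with_def by (metis image_subsetI lessThan_iff set_pref)

lemma ex_between:
  fixes f :: "nat \<Rightarrow> nat"
  assumes "f 0 \<le> N" "\<And>k. k \<le> f k"
  obtains k where "f k \<le> N" "N < f (Suc k)"
proof -
  define k where "k = (LEAST k. N < f (Suc k))"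
  have "N < f (Suc N)" using assms(2)[of "Suc N"] by simp
  then have "N < f (Suc k)" unfolding k_def by (rule LeastI)
  moreover have "f k \<le> N"
  proof (cases k)
    case (Suc j)
    then show ?thesis using not_less_Least[of j "\<lambda>k. N < f (Suc k)"] k_def by simp
  qed (use assms in simp)
  ultimately show ?thesis using that by blast
qed

section \<open>Products of two words with a long common prefix\<close>

text \<open>Euclid's algorithm on words: the shorter word u is a prefix of the longer, v = u v', and
  cancelling one u leaves the same situation for u and v', with a common prefix that is still long
  enough. If u commutes with v', it commutes with v.\<close>

lemma two_word_code:
  fixes u v :: "'a list"
  assumes "prefix e (u @ concat us)" "prefix e (v @ concat vs)"
    and "set us \<subseteq> {u, v}" "set vs \<subseteq> {u, v}" "length u + length v \<le> length e"
  shows "u @ v = v @ u"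
  using assms
proof (induction "length u + length v" arbitrary: u v e us vs rule: less_induct)
  case less
  have main: "u @ v = v @ u"
    if h: "length u \<le> length v" "prefix e (u @ concat us)" "prefix e (v @ concat vs)"
      "set us \<subseteq> {u, v}" "set vs \<subseteq> {u, v}" "length u + length v \<le> length e"
      and IH: "\<And>(u' :: 'a list) v' e us vs. length u' + length v' < length u + length v \<Longrightarrow>
        prefix e (u' @ concat us) \<Longrightarrow> prefix e (v' @ concat vs) \<Longrightarrow> set us \<subseteq> {u', v'} \<Longrightarrow>
        set vs \<subseteq> {u', v'} \<Longrightarrow> length u' + length v' \<le> length e \<Longrightarrow> u' @ v' = v' @ u'"
    for u v :: "'a list" and us vs e
  proof (cases "u = []")
    case False
    have "prefix u e" using h(2,6) by (meson add_leD1 prefix_length_prefix prefixI)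
    moreover have "prefix v e" using h(3,6) by (meson add_leD2 prefix_length_prefix prefixI)
    ultimately have "prefix u v" using h(1) prefix_length_prefix by blast
    then obtain v' where v: "v = u @ v'" by (auto simp: prefix_def)
    obtain e' where e: "e = u @ e'" using \<open>prefix u e\<close> by (auto simp: prefix_def)
    have rewr: "\<exists>us'. set us' \<subseteq> {u, v'} \<and> concat us' = concat us" if "set us \<subseteq> {u, v}" for us
      using that
    proof (induction us)
      case (Cons g us)
      then obtain us' where us': "set us' \<subseteq> {u, v'}" "concat us' = concat us" by auto
      consider "g = u" | "g = v" using Cons.prems by auto
      then show ?case
      proof cases
        case 1 then show ?thesis using us' by (intro exI[of _ "u # us'"]) auto
      next
        case 2 then show ?thesis using us' v by (intro exI[of _ "u # v' # us'"]) auto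
      qed
    qed (auto intro: exI[of _ "[]"])
    have e1: "prefix e' (concat us)" using h(2) e by simp
    have e2: "prefix e' (v' @ concat vs)" using h(3) e v by simp
    have le: "length u + length v' \<le> length e'" using h(6) e v by simp
    then have "us \<noteq> []" using e1 False by auto
    then obtain g us1 where us: "us = g # us1" by (cases us) auto
    obtain us1' where us1': "set us1' \<subseteq> {u, v'}" "concat us1' = concat us1"
      using rewr[of us1] h(4) us by auto
    \<comment> \<open>Both u and v = u v' begin with u, so after the cancellation one product begins
      with u again and the other with v'.\<close>
    have "\<exists>us2. set us2 \<subseteq> {u, v'} \<and> concat us = u @ concat us2"
    proof (cases "g = u")
      case True then show ?thesis using us1' us by (intro exI[of _ us1']) auto
    next
      case False
      then have "g = v" using h(4) us by auto
      then show ?thesis using us1' us v by (intro exI[of _ "v' # us1'"]) auto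
    qed
    then obtain us2 where "set us2 \<subseteq> {u, v'}" "concat us = u @ concat us2" by auto
    moreover obtain vs2 where "set vs2 \<subseteq> {u, v'}" "concat vs2 = concat vs"
      using rewr h(5) by blast
    ultimately have "u @ v' = v' @ u"
      using IH[of u v' e' us2 vs2] e1 e2 le False v by auto
    then show ?thesis using v by simp
  qed simp
  show ?case
  proof (cases "length u \<le> length v")
    case True
    show ?thesis by (rule main[OF True less.prems]) (rule less.hyps)
  next
    case False
    have "v @ u = u @ v"
    proof (rule main[of v u e vs us])
      show "length u' + length v' < length v + length u \<Longrightarrow>
        prefix e (u' @ concat us) \<Longrightarrow> prefix e (v' @ concat vs) \<Longrightarrow> set us \<subseteq> {u', v'} \<Longrightarrow>
        set vs \<subseteq> {u', v'} \<Longrightarrow> length u' + length v' \<le> length e \<Longrightarrow> u' @ v' = v' @ u'" for u' v' e :: "'a list" and us vs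
        by (rule less.hyps[of u' v' e us vs]) auto
    qed (use False less.prems in auto)
    then show ?thesis by simp
  qed
qed

text \<open>Reversal turns the common suffix into a common prefix of two products whose first
  factors are the reversed images of 0 and 1.\<close>

lemma common_suffix_commute:
  assumes "suffix e (morph \<psi> (h @ [0]))" "suffix e (morph \<psi> (h' @ [1]))"
    and "set h \<subseteq> {..<2}" "set h' \<subseteq> {..<2}" "length (\<psi> 0) + length (\<psi> 1) \<le> length e"
  shows "\<psi> 0 @ \<psi> 1 = \<psi> 1 @ \<psi> 0"
proof -
  have "rev (\<psi> 0) @ rev (\<psi> 1) = rev (\<psi> 1) @ rev (\<psi> 0)"
  proof (rule two_word_code)
    show "prefix (rev e) (rev (\<psi> 0) @ concat (map (rev \<circ> \<psi>) (rev h)))"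
      using assms(1) by (simp add: suffix_to_prefix morph_def rev_concat rev_map)
    show "prefix (rev e) (rev (\<psi> 1) @ concat (map (rev \<circ> \<psi>) (rev h')))"
      using assms(2) by (simp add: suffix_to_prefix morph_def rev_concat rev_map)
    show "set (map (rev \<circ> \<psi>) (rev h)) \<subseteq> {rev (\<psi> 0), rev (\<psi> 1)}"
      "set (map (rev \<circ> \<psi>) (rev h')) \<subseteq> {rev (\<psi> 0), rev (\<psi> 1)}"
      using assms(3,4) by (fastforce simp: less_2_cases_iff)+
  qed (use assms in auto)
  then show ?thesis by (metis rev_append rev_rev_ident)
qed

section \<open>Words renormalised by a standard morphism\<close>

locale renormalised_word =
  fixes p :: "nat list" and z :: "gen list" and x :: "nat \<Rightarrow> nat"
  assumes z: "set z = {Gb, Gbeta}" and binary: "\<And>i. x i < 2"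
    and renorm: "affine_image p (phi z) x x"
begin

lemma binary_prefix: "starts_with x v \<Longrightarrow> set v \<subseteq> {..<2}"
  using set_starts_with binary by blast

text \<open>\<open>\<kappa>\<close> spans the contracting left eigenvector of the incidence matrix; its irrationality
  makes \<^term>\<open>wt \<kappa>\<close> determine the numbers of zeros and ones.\<close>

lemma bounded_weight:
  obtains \<kappa> l K :: real where "\<kappa> > 0"
    "\<And>v. set v \<subseteq> {..<2} \<Longrightarrow> wt \<kappa> (morph (phi z) v) = l * wt \<kappa> v"
    "\<And>v. starts_with x v \<Longrightarrow> \<bar>wt \<kappa> v\<bar> \<le> K"
    "\<And>v w. set v \<subseteq> {..<2} \<Longrightarrow> set w \<subseteq> {..<2} \<Longrightarrow> wt \<kappa> v = wt \<kappa> w \<Longrightarrow> length v = length w"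
proof -
  have z': "set z \<subseteq> {Gb, Gbeta}" "Gb \<in> set z" "Gbeta \<in> set z" using z by auto
  note cnt = count_phi_standard[OF z'(1)]
  obtain \<kappa> l :: real where \<kappa>: "\<kappa> > 0" and l: "0 < l" "l < 1"
    and eig: "real (count_list (phi z 0) 1) - \<kappa> * count_list (phi z 0) 0 = - l * \<kappa>"
      "real (count_list (phi z 1) 1) - \<kappa> * count_list (phi z 1) 0 = l"
    and irr: "\<And>e f :: int. of_int e - \<kappa> * of_int f = 0 \<Longrightarrow> e = 0 \<and> f = 0"
    using contracting_eigenvector[OF cnt(1) cnt(4)[OF z'(2)] cnt(5)[OF z'(3)] cnt(2,3)] by blast
  have mult: "wt \<kappa> (morph (phi z) v) = l * wt \<kappa> v" if "set v \<subseteq> {..<2}" for v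
  proof -
    have "wt \<kappa> (phi z 0) = - l * \<kappa>" "wt \<kappa> (phi z 1) = l" using eig by (auto simp: wt_def)
    then show ?thesis using wt_morph[OF that] by (simp add: wt_def[of _ v] algebra_simps)
  qed
  have inj: "length v = length w" if "set v \<subseteq> {..<2}" "set w \<subseteq> {..<2}" "wt \<kappa> v = wt \<kappa> w" for v w
  proof -
    have "real_of_int (int (count_list v 1) - int (count_list w 1)) - \<kappa> * of_int (int (count_list v 0) - int (count_list w 0)) = 0"
      using that(3) by (simp add: wt_def algebra_simps)
    then have "count_list v 1 = count_list w 1" "count_list v 0 = count_list w 0"
      using irr by fastforce+
    then show ?thesis using length_binary that by metis
  qed
  \<comment> \<open>\<open>W\<close> bounds the length of an incomplete block and \<open>C\<close>
    the weight of the offset plus such a block. \<open>K\<close> solves C + l K = K, so the bound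
    reproduces itself in the induction.\<close>
  define W where "W = length (phi z 0) + length (phi z 1)"
  define C where "C = (1 + \<kappa>) * real (length p + W)"
  define K where "K = C / (1 - l)"
  have C: "0 \<le> C" using \<kappa> by (simp add: C_def)
  have K: "C + l * K = K" using l by (simp add: K_def field_simps)
  have "C \<le> K" using C l by (simp add: K_def field_simps)
  have bound: "\<bar>wt \<kappa> v\<bar> \<le> K" if "starts_with x v" for v
    using that
  proof (induction "length v" arbitrary: v rule: less_induct)
    case less
    define f where "f k = length p + length (morph (phi z) (pref x k))" for k
    have f: "2 * k \<le> f k" for k
      using length_morph_ge[of "pref x k" 2 "phi z"] length_phi_standard[OF z] binary
      by (fastforce simp: f_def set_pref)
    show ?case
    proof (cases "length v < length p")
      case True
      have "\<bar>wt \<kappa> v\<bar> \<le> (1 + \<kappa>) * real (length v)" using abs_wt_le \<kappa> by blast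
      also have "\<dots> \<le> C" unfolding C_def using True \<kappa> by (intro mult_left_mono) auto
      finally show ?thesis using \<open>C \<le> K\<close> by simp
    next
      case False
      have "f 0 \<le> length v" using False by (simp add: f_def)
      moreover have "k \<le> f k" for k using f[of k] by linarith
      ultimately obtain k where k: "f k \<le> length v" "length v < f (Suc k)" by (rule ex_between)
      define w where "w = drop (f k) v"
      have v: "v = (p @ morph (phi z) (pref x k)) @ w"
        using starts_with_extend[OF affine_imageD[OF renorm starts_with_pref] less.prems, of k] k
        by (simp add: f_def w_def)
      have "length w < length (phi z (x k))" using k v by (simp add: f_def pref_Suc)
      also have "\<dots> \<le> W" using binary[of k] by (auto simp: W_def less_2_cases_iff)
      finally have w: "length w \<le> W" by simp
      have "\<bar>wt \<kappa> (pref x k)\<bar> \<le> K"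
      proof (cases "k = 0")
        case True then show ?thesis using C \<open>C \<le> K\<close> by simp
      next
        case False
        then have "k < length v" using f[of k] k by linarith
        then show ?thesis using less.hyps[of "pref x k"] by simp
      qed
      then have 1: "\<bar>wt \<kappa> (morph (phi z) (pref x k))\<bar> \<le> l * K"
        using mult[OF binary_prefix[OF starts_with_pref]] l by (simp add: abs_mult mult_left_mono)
      have "\<bar>wt \<kappa> p\<bar> + \<bar>wt \<kappa> w\<bar> \<le> (1 + \<kappa>) * real (length p) + (1 + \<kappa>) * real (length w)"
        using abs_wt_le[OF \<kappa>] add_mono by blast
      also have "\<dots> \<le> (1 + \<kappa>) * real (length p) + (1 + \<kappa>) * real W"
        using w \<kappa> by (intro add_left_mono mult_left_mono) auto
      also have "\<dots> = C" by (simp add: C_def algebra_simps)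
      finally show ?thesis using 1 K v by (simp)
    qed
  qed
  show ?thesis using that[OF \<kappa> mult bound inj] by blast
qed

text \<open>For a period d, the prefix of length n d weighs n times as much as the prefix of length
  d. Boundedness makes the latter weight 0, and the only binary word of weight 0 is empty.\<close>

lemma aperiodic:
  assumes "shift d x = x"
  shows "d = 0"
proof -
  obtain \<kappa> l K :: real where bound: "\<And>v. starts_with x v \<Longrightarrow> \<bar>wt \<kappa> v\<bar> \<le> K"
    and inj: "\<And>v w. set v \<subseteq> {..<2} \<Longrightarrow> set w \<subseteq> {..<2} \<Longrightarrow> wt \<kappa> v = wt \<kappa> w \<Longrightarrow> length v = length w"
    by (rule bounded_weight) blast
  have mult: "wt \<kappa> (pref x (n * d)) = real n * wt \<kappa> (pref x d)" for n
  proof (induction n)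
    case (Suc n)
    then show ?case using pref_add[of x d "n * d"] assms by (simp add: algebra_simps)
  qed simp
  have "wt \<kappa> (pref x d) = 0"
  proof (rule ccontr)
    assume "wt \<kappa> (pref x d) \<noteq> 0"
    then obtain n where "K < real n * \<bar>wt \<kappa> (pref x d)\<bar>"
      using ex_less_of_nat_mult[of "\<bar>wt \<kappa> (pref x d)\<bar>"] by auto
    moreover have "\<bar>wt \<kappa> (pref x (n * d))\<bar> \<le> K" using bound by simp
    ultimately show False using mult by (simp add: abs_mult)
  qed
  then have "length (pref x d) = length []"
    using inj[of "pref x d" "[]"] binary_prefix[of "pref x d"] by simp
  then show ?thesis by simp
qed

lemma shift_inj:
  assumes "shift i u = x" "shift j u = x"
  shows "i = j"
proof -
  have "i = j" if "shift i u = x" "shift j u = x" "i \<le> j" for i j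
  proof -
    have "shift (j - i) x = shift (j - i) (shift i u)" using that by simp
    also have "\<dots> = shift j u" using that(3) by (simp add: shift_def fun_eq_iff flip: add.assoc)
    finally show ?thesis using aperiodic that by fastforce
  qed
  then show ?thesis using assms by (metis nat_le_linear)
qed

text \<open>Prefixes of x have bounded weight and \<psi> maps them to prefixes, which forces
  (-\<kappa>, 1) to be a left eigenvector for \<psi> as well. Both morphisms then scale weights, so
  the two compositions give equal weights and hence equal lengths. Commuting images would be powers
  of one word of weight 0.\<close>

lemma fixing_morphism:
  assumes bin: "\<And>c. c < 2 \<Longrightarrow> set (\<psi> c) \<subseteq> {..<2}" and fixed: "affine_image [] \<psi> x x"
    and ne: "\<psi> 0 \<noteq> []"
  shows "set h \<subseteq> {..<2} \<Longrightarrow> length (morph (phi z) (morph \<psi> h)) = length (morph \<psi> (morph (phi z) h))"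
    and "\<psi> 0 @ \<psi> 1 \<noteq> \<psi> 1 @ \<psi> 0"
proof -
  obtain \<kappa> l K :: real where \<kappa>: "\<kappa> > 0"
    and mult: "\<And>v. set v \<subseteq> {..<2} \<Longrightarrow> wt \<kappa> (morph (phi z) v) = l * wt \<kappa> v"
    and bound: "\<And>v. starts_with x v \<Longrightarrow> \<bar>wt \<kappa> v\<bar> \<le> K"
    and inj: "\<And>v w. set v \<subseteq> {..<2} \<Longrightarrow> set w \<subseteq> {..<2} \<Longrightarrow> wt \<kappa> v = wt \<kappa> w \<Longrightarrow> length v = length w"
    by (rule bounded_weight) blast
  \<comment> \<open>\<open>E\<close> vanishes exactly when (-\<kappa>, 1) is a left eigenvector of
    the incidence matrix of \<psi>.\<close>
  define E where "E = wt \<kappa> (\<psi> 0) + \<kappa> * wt \<kappa> (\<psi> 1)"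
  have psi: "wt \<kappa> (morph \<psi> v) = real (count_list v 0) * E + wt \<kappa> v * wt \<kappa> (\<psi> 1)"
    if "set v \<subseteq> {..<2}" for v
    using wt_morph[OF that, of \<kappa> \<psi>] by (simp add: E_def wt_def[of _ v] algebra_simps)
  have "E = 0"
  proof (rule ccontr)
    assume "E \<noteq> 0"
    define Q where "Q = K + K * \<bar>wt \<kappa> (\<psi> 1)\<bar>"
    \<comment> \<open>For nonzero \<open>E\<close> the number of zeros in a prefix would be bounded,
      and together with the bounded weight this would bound its length N.\<close>
    have le: "real N \<le> K + (1 + \<kappa>) * (Q / \<bar>E\<bar>)" for N
    proof -
      define v where "v = pref x N"
      have v: "set v \<subseteq> {..<2}" "starts_with x v" using binary_prefix by (auto simp: v_def)
      have "starts_with x (morph \<psi> v)" using affine_imageD[OF fixed v(2)] by simp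
      then have "\<bar>real (count_list v 0) * E + wt \<kappa> v * wt \<kappa> (\<psi> 1)\<bar> \<le> K"
        using bound psi v by metis
      moreover have "\<bar>wt \<kappa> v * wt \<kappa> (\<psi> 1)\<bar> \<le> K * \<bar>wt \<kappa> (\<psi> 1)\<bar>"
        using bound[OF v(2)] by (simp add: abs_mult mult_right_mono)
      ultimately have "\<bar>real (count_list v 0) * E\<bar> \<le> Q" unfolding Q_def by linarith
      then have "real (count_list v 0) \<le> Q / \<bar>E\<bar>" using \<open>E \<noteq> 0\<close> by (simp add: abs_mult field_simps)
      then have "(1 + \<kappa>) * real (count_list v 0) \<le> (1 + \<kappa>) * (Q / \<bar>E\<bar>)"
        using \<kappa> by (intro mult_left_mono) auto
      moreover have "real N = wt \<kappa> v + (1 + \<kappa>) * real (count_list v 0)"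
        using length_binary[OF v(1)] by (simp add: v_def wt_def algebra_simps)
      ultimately show ?thesis using bound[OF v(2)] by linarith
    qed
    obtain N where "K + (1 + \<kappa>) * (Q / \<bar>E\<bar>) < real N" using reals_Archimedean2 by blast
    then show False using le[of N] by simp
  qed
  then have psi': "wt \<kappa> (morph \<psi> v) = wt \<kappa> (\<psi> 1) * wt \<kappa> v" if "set v \<subseteq> {..<2}" for v
    using psi[OF that] by simp
  {
    assume h: "set h \<subseteq> {..<2}"
    have 1: "set (morph \<psi> h) \<subseteq> {..<2}" by (rule set_morph_binary[OF bin h])
    have 2: "set (morph (phi z) v) \<subseteq> {..<2}" if "set v \<subseteq> {..<2}" for v
      by (rule set_morph_binary[OF set_phi that])
    have 3: "set (morph \<psi> (morph (phi z) h)) \<subseteq> {..<2}" by (rule set_morph_binary[OF bin 2[OF h]])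
    show "length (morph (phi z) (morph \<psi> h)) = length (morph \<psi> (morph (phi z) h))"
      by (rule inj[OF 2[OF 1] 3]) (simp add: mult[OF 1] mult[OF h] psi'[OF h] psi'[OF 2[OF h]])
  }
  show "\<psi> 0 @ \<psi> 1 \<noteq> \<psi> 1 @ \<psi> 0"
  proof
    assume "\<psi> 0 @ \<psi> 1 = \<psi> 1 @ \<psi> 0"
    then obtain m n r where r: "concat (replicate m r) = \<psi> 0" "concat (replicate n r) = \<psi> 1"
      using comm_append_are_replicate by blast
    have rep: "wt \<kappa> (concat (replicate m r)) = real m * wt \<kappa> r" for m
      by (induction m) (auto simp: algebra_simps)
    have m: "m > 0" using r ne by (cases m) auto
    have "(real m + \<kappa> * real n) * wt \<kappa> r = 0"
      using \<open>E = 0\<close> unfolding E_def r[symmetric] rep by (simp add: algebra_simps)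
    moreover have "real m + \<kappa> * real n > 0" using m \<kappa> by (simp add: add_pos_nonneg)
    ultimately have "wt \<kappa> (\<psi> 0) = wt \<kappa> []" using rep[of m] r by simp
    then show False using inj[of "\<psi> 0" "[]"] bin[of 0] ne by simp
  qed
qed

lemma starts_with_renorm: "starts_with x v \<Longrightarrow> starts_with x (p @ morph (phi z) v)"
  using affine_imageD[OF renorm] .

text \<open>The images under \<open>phi z\<close> of h0 and h'1 still end in 0 and 1. Both are
  followed by the image of g and then by the first letter common to all images, so the shared
  continuation grows in every round.\<close>

lemma left_special:
  assumes "x i = 0" "x j = 1"
  shows "\<exists>h h' g. starts_with x (h @ [0] @ g) \<and> starts_with x (h' @ [1] @ g) \<and> n \<le> length g"
proof (induction n)
  case 0
  have "starts_with x (pref x i @ [0] @ [])" "starts_with x (pref x j @ [1] @ [])"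
    using starts_with_pref[of x "Suc i"] starts_with_pref[of x "Suc j"] assms by (simp_all add: pref_Suc)
  then show ?case by blast
next
  case (Suc n)
  then obtain h h' g where g: "starts_with x (h @ [0] @ g)" "starts_with x (h' @ [1] @ g)" "n \<le> length g"
    by metis
  have z': "set z \<subseteq> {Gb, Gbeta}" "z \<noteq> []" using z by force+
  obtain r where r: "\<forall>c<2. \<exists>v. phi z c = r # v"
    using phi_standard_first[OF z'] by metis
  have step: "\<exists>h'. starts_with x (h' @ [c] @ morph (phi z) g @ [r])"
    if c: "c < 2" "starts_with x (h @ [c] @ g)" for h c
  proof -
    define d where "d = x (length (h @ [c] @ g))"
    have "starts_with x ((h @ [c] @ g) @ [d])" using that starts_with_snoc[of x] d_def by blast
    then have 1: "starts_with x (p @ morph (phi z) ((h @ [c] @ g) @ [d]))" by (rule starts_with_renorm)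
    obtain v where "phi z d = r # v" using r binary d_def by blast
    moreover obtain v' where "phi z c = v' @ [c]" using phi_standard_ends[OF z'(1) c(1)] by blast
    ultimately have "starts_with x (((p @ morph (phi z) h @ v') @ [c] @ morph (phi z) g @ [r]) @ v)"
      using 1 by simp
    then show ?thesis using starts_with_appendD by blast
  qed
  have "1 * length g \<le> length (morph (phi z) g)"
  proof (rule length_morph_ge)
    fix c assume "c \<in> set g"
    then have "c < 2" using binary_prefix[OF g(1)] by auto
    then show "1 \<le> length (phi z c)" using length_phi_standard[OF z] by fastforce
  qed
  then have "Suc n \<le> length (morph (phi z) g @ [r])" using g by simp
  moreover obtain k k' where "starts_with x (k @ [0] @ morph (phi z) g @ [r])"
      "starts_with x (k' @ [1] @ morph (phi z) g @ [r])"
    using step[OF _ g(1)] step[OF _ g(2)] by auto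
  ultimately show ?case by metis
qed

text \<open>If \<open>h0\<close> and \<open>h'1\<close> precede the same long word \<open>g\<close> and \<open>\<psi>(h0)\<close>, \<open>\<psi>(h'1)\<close> share the suffix \<open>e\<close>,
  then, with \<open>\<sigma>\<close> denoting \<^term>\<open>phi z\<close>, the words \<open>\<psi>(p\<sigma>(h0))\<close> and \<open>\<psi>(p\<sigma>(h'1))\<close> share the suffix
  \<open>\<sigma>(e)s\<close>, where \<open>s\<close> is the prefix of \<open>\<sigma>(\<psi>(g))\<close> of length \<open>|\<psi>(p)| - |p|\<close>.\<close>

theorem fixed_imp_no_offset:
  assumes bin: "\<And>c. c < 2 \<Longrightarrow> set (\<psi> c) \<subseteq> {..<2}" and len: "\<And>c. c < 2 \<Longrightarrow> 2 \<le> length (\<psi> c)"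
    and fixed: "affine_image [] \<psi> x x" and occ: "x i = 0" "x j = 1"
  shows "p = []"
proof (rule ccontr)
  assume "p \<noteq> []"
  let ?\<sigma> = "morph (phi z)" and ?\<psi> = "morph \<psi>"
  have ne: "\<psi> 0 \<noteq> []" using len[of 0] by auto
  note comm = fixing_morphism(1)[of \<psi>, OF bin fixed ne]
  have z': "set z \<subseteq> {Gb, Gbeta}" using z by auto
  have pbin: "set p \<subseteq> {..<2}"
    using binary_prefix[OF starts_with_renorm[of "[]"]] by (simp add: starts_with_def)
  \<comment> \<open>The common suffix will gain at least \<open>d\<close> letters per round;
    \<open>d\<close> is positive because \<psi> at least doubles the length of the nonempty
    \<open>p\<close>.\<close>
  define d where "d = length (?\<psi> p) - length p"
  have "2 * length p \<le> length (?\<psi> p)" using pbin len by (intro length_morph_ge) auto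
  then have d: "0 < d" "length (?\<psi> p) = length p + d" using \<open>p \<noteq> []\<close> by (cases p; simp add: d_def)+
  have fixp: "starts_with x (?\<psi> v)" if "starts_with x v" for v using affine_imageD[OF fixed that] by simp
  have len\<sigma>: "length v \<le> length (?\<sigma> v)" if "set v \<subseteq> {..<2}" for v
  proof -
    have "1 * length v \<le> length (?\<sigma> v)"
      by (rule length_morph_ge) (use that length_phi_standard[OF z] in fastforce)
    then show ?thesis by simp
  qed
  have grow: "\<exists>h h' g e. starts_with x (h @ [0] @ g) \<and> starts_with x (h' @ [1] @ g) \<and> d \<le> length g \<and>
      suffix e (?\<psi> (h @ [0])) \<and> suffix e (?\<psi> (h' @ [1])) \<and> n \<le> length e" for n
  proof (induction n)
    case 0
    then show ?case using left_special[OF occ, of d] by (metis le0 suffix_bot.extremum)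
  next
    case (Suc n)
    then obtain h h' g e where g: "starts_with x (h @ [0] @ g)" "starts_with x (h' @ [1] @ g)" "d \<le> length g"
      and e: "suffix e (?\<psi> (h @ [0]))" "suffix e (?\<psi> (h' @ [1]))" "n \<le> length e" by blast
    define s where "s = take d (?\<sigma> (?\<psi> g))"
    have gbin: "set g \<subseteq> {..<2}" using binary_prefix[OF g(1)] by auto
    have psig: "set (?\<psi> g) \<subseteq> {..<2}" by (rule set_morph_binary[OF bin gbin])
    have "1 * length g \<le> length (?\<psi> g)"
      by (rule length_morph_ge) (use gbin len in fastforce)
    then have lens: "length s = d" using len\<sigma>[OF psig] g(3) by (simp add: s_def)
    have step: "\<exists>k. starts_with x (k @ [c] @ ?\<sigma> g) \<and> suffix (?\<sigma> e @ s) (?\<psi> (k @ [c]))"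
      if c: "c < 2" and h: "starts_with x (h @ [c] @ g)" and suf: "suffix e (?\<psi> (h @ [c]))" for h c
    proof -
      obtain v where v: "phi z c = v @ [c]" using phi_standard_ends[OF z' c] by blast
      define k where "k = p @ ?\<sigma> h @ v"
      have kc: "k @ [c] = p @ ?\<sigma> (h @ [c])" using v by (simp add: k_def)
      have 1: "starts_with x (k @ [c] @ ?\<sigma> g)" using starts_with_renorm[OF h] v by (simp add: k_def)
      then have "starts_with x (k @ [c])" using starts_with_appendD by (metis append_assoc)
      then have 2: "starts_with x (?\<psi> (k @ [c]))" by (rule fixp)
      have "starts_with x (p @ ?\<sigma> (?\<psi> (h @ [c] @ g)))" using starts_with_renorm[OF fixp[OF h]] .
      then have "starts_with x ((p @ ?\<sigma> (?\<psi> (h @ [c])) @ s) @ drop d (?\<sigma> (?\<psi> g)))"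
        by (simp add: s_def)
      then have 3: "starts_with x (p @ ?\<sigma> (?\<psi> (h @ [c])) @ s)" by (rule starts_with_appendD)
      have "set (h @ [c]) \<subseteq> {..<2}" using binary_prefix[OF h] by auto
      \<comment> \<open>Both words are prefixes of x. Their lengths agree because the two morphisms
        composed in either order give images of equal length, and \<open>s\<close> has exactly the
        \<open>d\<close> letters by which the image of \<open>p\<close> exceeds
        \<open>p\<close>.\<close>
      then have "length (?\<psi> (k @ [c])) = length (p @ ?\<sigma> (?\<psi> (h @ [c])) @ s)"
        unfolding kc using comm[of "h @ [c]"] d(2) lens by simp
      then have eq: "?\<psi> (k @ [c]) = p @ ?\<sigma> (?\<psi> (h @ [c])) @ s" using starts_with_eq[OF 2 3] by blast
      obtain f where "?\<psi> (h @ [c]) = f @ e" using suf by (auto simp: suffix_def)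
      then have "?\<psi> (k @ [c]) = (p @ ?\<sigma> f) @ ?\<sigma> e @ s" using eq by (metis append_assoc morph_append)
      then show ?thesis using 1 unfolding suffix_def by blast
    qed
    obtain k where k: "starts_with x (k @ [0] @ ?\<sigma> g)" "suffix (?\<sigma> e @ s) (?\<psi> (k @ [0]))"
      using step[OF _ g(1) e(1)] by auto
    obtain k' where k': "starts_with x (k' @ [1] @ ?\<sigma> g)" "suffix (?\<sigma> e @ s) (?\<psi> (k' @ [1]))"
      using step[OF _ g(2) e(2)] by auto
    have "set e \<subseteq> {..<2}"
      using e(1) binary_prefix[OF fixp[OF starts_with_appendD[of x "h @ [0]" g]]] g(1)
      by (fastforce dest: set_mono_suffix)
    then have "Suc n \<le> length (?\<sigma> e @ s)" using len\<sigma>[of e] lens d e(3) by simp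
    moreover have "d \<le> length (?\<sigma> g)" using len\<sigma>[OF gbin] g(3) by simp
    ultimately show ?case using k k' by blast
  qed
  obtain h h' g e where sw: "starts_with x (h @ [0] @ g)" "starts_with x (h' @ [1] @ g)"
      and e: "suffix e (?\<psi> (h @ [0]))" "suffix e (?\<psi> (h' @ [1]))" "length (\<psi> 0) + length (\<psi> 1) \<le> length e"
    using grow[of "length (\<psi> 0) + length (\<psi> 1)"] by blast
  have "set h \<subseteq> {..<2}" "set h' \<subseteq> {..<2}" using binary_prefix[OF sw(1)] binary_prefix[OF sw(2)] by simp_all
  then have "\<psi> 0 @ \<psi> 1 = \<psi> 1 @ \<psi> 0" using common_suffix_commute[OF e(1,2) _ _ e(3)] by blast
  then show False using fixing_morphism(2)[of \<psi>, OF bin fixed ne] by blast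
qed

end

section \<open>Fixed points of primitive substitutions\<close>

lemma ex_image_word:
  assumes "\<And>i. \<psi> (x i) \<noteq> []"
  shows "\<exists>y. affine_image [] \<psi> x y"
proof -
  define y where "y i = morph \<psi> (pref x (Suc i)) ! i" for i
  have len: "N \<le> length (morph \<psi> (pref x N))" for N
    using length_morph_ge[of "pref x N" 1 \<psi>] assms by (auto simp: set_pref Suc_le_eq)
  have ext: "\<exists>v. morph \<psi> (pref x (N + k)) = morph \<psi> (pref x N) @ v" for N k
    by (simp add: pref_add)
  have "morph \<psi> (pref x N) = pref y (length (morph \<psi> (pref x N)))" for N
  proof (rule nth_equalityI)
    fix i assume i: "i < length (morph \<psi> (pref x N))"
    have i': "i < length (morph \<psi> (pref x (Suc i)))" using len[of "Suc i"] by simp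
    obtain v where v: "morph \<psi> (pref x (N + Suc i)) = morph \<psi> (pref x N) @ v" using ext by blast
    obtain v' where v': "morph \<psi> (pref x (Suc i + N)) = morph \<psi> (pref x (Suc i)) @ v'" using ext by blast
    have "morph \<psi> (pref x N) ! i = morph \<psi> (pref x (Suc i)) ! i"
      using v v' i i' by (metis add.commute nth_append)
    then show "morph \<psi> (pref x N) ! i = pref y (length (morph \<psi> (pref x N))) ! i"
      using i by (simp add: y_def)
  qed simp
  then have "affine_image [] \<psi> x y" unfolding affine_image_iff_pref starts_with_def by simp
  then show ?thesis by blast
qed

lemma ex_fixed_point:
  assumes "is_substitution n \<psi>"
  shows "\<exists>u. fixed_point n \<psi> u"
proof -
  obtain c x where c: "c < n" "\<psi> c = c # x"
    and grow: "filterlim (\<lambda>m. length (iter_morph \<psi> m [c])) at_top at_top"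
    using assms unfolding is_substitution_def by blast
  have alph: "\<And>c. c < n \<Longrightarrow> set (\<psi> c) \<subseteq> {0..<n}" using assms unfolding is_substitution_def by blast
  define W where "W m = iter_morph \<psi> m [c]" for m
  have W0: "W 0 = [c]" and WS: "W (Suc m) = morph \<psi> (W m)" for m by (simp_all add: W_def iter_morph_def)
  have "prefix (W m) (W (Suc m))" for m
  proof (induction m)
    case 0 then show ?case using c by (simp add: W0 WS)
  next
    case (Suc m)
    then obtain v where "W (Suc m) = W m @ v" by (auto simp: prefix_def)
    then have "W (Suc (Suc m)) = W (Suc m) @ morph \<psi> v" using WS by (metis morph_append)
    then show ?case by simp
  qed
  then have mono: "prefix (W m) (W m')" if "m \<le> m'" for m m'
    using that by (rule prefix_order.lift_Suc_mono_le)
  have long: "\<exists>m. i < length (W m)" for i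
  proof -
    have "eventually (\<lambda>m. Suc i \<le> length (W m)) at_top" using grow unfolding W_def filterlim_at_top by blast
    then obtain m where "Suc i \<le> length (W m)" by (auto simp: eventually_at_top_linorder)
    then show ?thesis by (intro exI[of _ m]) simp
  qed
  define K where "K i = (SOME m. i < length (W m))" for i
  have K: "i < length (W (K i))" for i unfolding K_def using long by (rule someI_ex)
  define u where "u i = W (K i) ! i" for i
  have uW: "starts_with u (W m)" for m unfolding starts_with_def
  proof (rule nth_equalityI)
    fix i assume i: "i < length (W m)"
    have "prefix (W m) (W (K i)) \<or> prefix (W (K i)) (W m)" using mono by (metis nat_le_linear)
    then show "W m ! i = pref u (length (W m)) ! i"
      using i K[of i] by (auto simp: u_def prefix_def nth_append)
  qed simp
  have setW: "set (W m) \<subseteq> {0..<n}" for m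
  proof (induction m)
    case (Suc m)
    then show ?case using alph by (fastforce simp: WS set_morph)
  qed (use c in \<open>simp add: W0\<close>)
  have "u i < n" for i using setW[of "K i"] K[of i] nth_mem by (fastforce simp: u_def)
  moreover have "starts_with u (morph \<psi> (pref u N))" for N
  proof -
    obtain m where "N < length (W m)" using long by blast
    then obtain v where "W m = pref u N @ v"
      using starts_with_extend[OF starts_with_pref uW, of N m] by auto
    then have "W (Suc m) = morph \<psi> (pref u N) @ morph \<psi> v" by (simp add: WS)
    then show ?thesis using uW[of "Suc m"] starts_with_appendD by metis
  qed
  ultimately show ?thesis unfolding fixed_point_iff affine_image_iff_pref by auto
qed

text \<open>The power \<chi> depends on \<psi> alone, so two fixed points can be compared through
  the same morphism.\<close>

lemma primitive_fixed_power:
  assumes "primitive_morph n \<psi>" "fixed_point n \<psi> u"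
  obtains \<chi> where "affine_image [] \<chi> u u" "\<And>c d. c < n \<Longrightarrow> d < n \<Longrightarrow> d \<in> set (\<chi> c)"
    and "\<And>v. fixed_point n \<psi> v \<Longrightarrow> affine_image [] \<chi> v v"
proof -
  obtain k where k: "\<forall>c<n. \<forall>d<n. d \<in> set (iter_morph \<psi> k [c])"
    using assms(1) unfolding primitive_morph_def by blast
  have "affine_image [] (\<lambda>c. iter_morph \<psi> k [c]) v v" if "fixed_point n \<psi> v" for v
    using that affine_image_iter unfolding fixed_point_iff by blast
  then show ?thesis using that[of "\<lambda>c. iter_morph \<psi> k [c]"] k assms(2) by blast
qed

lemma affine_image_recurrent:
  assumes "affine_image [] \<psi> x y" "\<And>i. \<psi> (x i) \<noteq> []" "x i = c" "N \<le> i" "d \<in> set (\<psi> c)"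
  shows "\<exists>j\<ge>N. y j = d"
proof -
  define P where "P = length (morph \<psi> (pref x i))"
  have "1 * i \<le> P" unfolding P_def
    using length_morph_ge[of "pref x i" 1 \<psi>] assms(2) by (auto simp: set_pref Suc_le_eq)
  obtain j where j: "j < length (\<psi> c)" "\<psi> c ! j = d" using assms(5) by (auto simp: in_set_conv_nth)
  have "starts_with (shift P y) (\<psi> c)" using affine_image_letter[OF assms(1), of i] assms(3) by (simp add: P_def)
  then have "y (P + j) = d" using starts_with_nth j by fastforce
  then show ?thesis using \<open>1 * i \<le> P\<close> assms(4) by (intro exI[of _ "P + j"]) auto
qed

lemma primitive_recurrent:
  assumes "primitive_morph n \<psi>" "fixed_point n \<psi> u" "d < n"
  shows "\<exists>i\<ge>N. u i = d"
proof -
  obtain \<chi> where \<chi>: "affine_image [] \<chi> u u" "\<And>c d. c < n \<Longrightarrow> d < n \<Longrightarrow> d \<in> set (\<chi> c)"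
    using primitive_fixed_power[OF assms(1,2)] by metis
  have u: "u i < n" for i using assms(2) by (simp add: fixed_point_iff)
  have "\<chi> (u i) \<noteq> []" for i using \<chi>(2)[OF u assms(3), of i] by auto
  then show ?thesis using affine_image_recurrent[OF \<chi>(1) _ refl le_refl \<chi>(2)[OF u assms(3)]] by blast
qed

lemma length_ge_2:
  assumes "a \<in> set v" "b \<in> set v" "a \<noteq> b"
  shows "2 \<le> length v"
proof (cases v)
  case (Cons c v')
  then show ?thesis using assms by (cases v') auto
qed (use assms in simp)

text \<open>With two letters in the alphabet, some power of \<psi> at least doubles lengths, so
  agreement on the first letter spreads to ever longer prefixes.\<close>

lemma primitive_fixed_point_unique:
  assumes prim: "primitive_morph n \<psi>" and u: "fixed_point n \<psi> u" and v: "fixed_point n \<psi> v"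
    and "a < n" "b < n" "a \<noteq> b" "u 0 = v 0"
  shows "u = v"
proof -
  obtain \<chi> where \<chi>: "affine_image [] \<chi> u u" "affine_image [] \<chi> v v"
      "\<And>c d. c < n \<Longrightarrow> d < n \<Longrightarrow> d \<in> set (\<chi> c)"
    using primitive_fixed_power[OF prim u] v by metis
  have un: "u i < n" for i using u by (simp add: fixed_point_iff)
  have eq: "pref u (Suc N) = pref v (Suc N)" for N
  proof (induction N)
    case 0 then show ?case using assms by (simp add: pref_Suc)
  next
    case (Suc N)
    define X where "X = morph \<chi> (pref u (Suc N))"
    have "2 * length (pref u (Suc N)) \<le> length X" unfolding X_def
    proof (rule length_morph_ge)
      fix c assume "c \<in> set (pref u (Suc N))"
      then have "c < n" using un by (auto simp: set_pref)
      then show "2 \<le> length (\<chi> c)" using length_ge_2[of a _ b] \<chi>(3) assms by blast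
    qed
    then have len: "Suc (Suc N) \<le> length X" by simp
    have "starts_with u X" using affine_imageD[OF \<chi>(1)] by (simp add: X_def)
    moreover have "starts_with v X" using affine_imageD[OF \<chi>(2)] Suc by (simp add: X_def)
    ultimately have "pref u (length X) = pref v (length X)" by (simp add: starts_with_def)
    then show ?case using take_pref[of "Suc (Suc N)" _ "length X"] len by (metis min_absorb1)
  qed
  show ?thesis
  proof
    fix i show "u i = v i" using eq[of i] by (metis lessI nth_pref)
  qed
qed

section \<open>Words coded by the fixed points of a closed set\<close>

definition recode :: "nat \<Rightarrow> nat \<Rightarrow> nat \<Rightarrow> nat" where
  "recode a b c = (if c = 0 then a else b)"

text \<open>Derived words are known only up to renaming, and elements of M may use other letters
  than 0 and 1. A binary word is therefore compared with their fixed points through an injective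
  renaming.\<close>

definition coded_fixed :: "(nat \<times> (nat \<Rightarrow> nat list)) set \<Rightarrow> (nat \<Rightarrow> nat) \<Rightarrow> bool" where
  "coded_fixed M x \<longleftrightarrow> range x = {0, 1} \<and>
     (\<exists>(m, \<chi>)\<in>M. \<exists>a b. a \<noteq> b \<and> fixed_point m \<chi> (\<lambda>k. recode a b (x k)))"

lemma starts_with_map: "starts_with x v \<Longrightarrow> starts_with (\<lambda>k. f (x k)) (map f v)"
  unfolding starts_with_def pref_def by (metis (no_types, lifting) length_map map_map comp_apply map_eq_conv)

lemma morph_map: "morph (\<lambda>c. map f (\<psi> c)) v = map f (morph \<psi> v)"
  by (induction v) auto

lemma coded_fixedE:
  assumes "coded_fixed M x"
  obtains m \<chi> a b where "(m, \<chi>) \<in> M" "a \<noteq> b" "a < m" "b < m" "fixed_point m \<chi> (\<lambda>k. recode a b (x k))"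
proof -
  obtain m \<chi> a b where 1: "(m, \<chi>) \<in> M" "a \<noteq> b" "fixed_point m \<chi> (\<lambda>k. recode a b (x k))"
    using assms unfolding coded_fixed_def by auto
  have "0 \<in> range x" "1 \<in> range x" using assms unfolding coded_fixed_def by auto
  then obtain i j where "x i = 0" "x j = 1" by auto
  moreover have "recode a b (x k) < m" for k using 1(3) by (simp add: fixed_point_iff)
  ultimately have "a < m" "b < m" unfolding recode_def by (metis, metis zero_neq_one)
  then show ?thesis using that 1 by blast
qed

text \<open>Such a word is determined by an element of M, the codes of 0 and 1 in its alphabet, and
  the first letter, all chosen from finite sets.\<close>

lemma finite_coded_fixed:
  assumes "closed_under_derivation M"
  shows "finite {x. coded_fixed M x}"
proof -
  define S where "S m \<chi> a b e = {x. range x = {0, 1} \<and> a \<noteq> b \<and> x 0 = e \<and>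
      fixed_point m \<chi> (\<lambda>k. recode a b (x k))}" for m \<chi> a b and e :: nat
  have uniq: "x = y" if M: "(m, \<chi>) \<in> M" and ab: "a < m" "b < m"
    and x: "x \<in> S m \<chi> a b e" and y: "y \<in> S m \<chi> a b e" for m \<chi> a b e x y
  proof -
    have "primitive_morph m \<chi>"
      using assms M unfolding closed_under_derivation_def primitive_substitution_def by auto
    then have "(\<lambda>k. recode a b (x k)) = (\<lambda>k. recode a b (y k))"
      by (rule primitive_fixed_point_unique[of m \<chi> _ _ a b]) (use ab x y in \<open>auto simp: S_def\<close>)
    then have eq: "recode a b (x k) = recode a b (y k)" for k by meson
    have "range x = {0, 1}" "range y = {0, 1}" and ne: "a \<noteq> b" using x y by (simp_all add: S_def)
    then have bin: "x k \<in> {0, 1}" "y k \<in> {0, 1}" for k by blast+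
    show ?thesis
    proof
      fix k show "x k = y k" using eq[of k] bin[of k] ne by (auto simp: recode_def)
    qed
  qed
  have fin: "finite (S m \<chi> a b e)" if "(m, \<chi>) \<in> M" "a < m" "b < m" for m \<chi> a b e
  proof (cases "S m \<chi> a b e = {}")
    case False
    then obtain x where "x \<in> S m \<chi> a b e" by blast
    then have "S m \<chi> a b e \<subseteq> {x}" using uniq[OF that] by blast
    then show ?thesis using finite_subset by blast
  qed simp
  have "{x. coded_fixed M x} \<subseteq> (\<Union>(m, \<chi>)\<in>M. \<Union>a<m. \<Union>b<m. \<Union>e\<in>{0, 1}. S m \<chi> a b e)"
  proof
    fix x assume "x \<in> {x. coded_fixed M x}"
    then have x: "coded_fixed M x" by simp
    then have r: "range x = {0, 1}" by (simp add: coded_fixed_def)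
    then have e: "x 0 \<in> {0, 1}" by blast
    from x obtain m \<chi> a b where 1: "(m, \<chi>) \<in> M" "a \<noteq> b" "a < m" "b < m" "fixed_point m \<chi> (\<lambda>k. recode a b (x k))"
      by (rule coded_fixedE)
    then have "x \<in> S m \<chi> a b (x 0)" using r by (simp add: S_def)
    then show "x \<in> (\<Union>(m, \<chi>)\<in>M. \<Union>a<m. \<Union>b<m. \<Union>e\<in>{0, 1}. S m \<chi> a b e)" using 1 e by blast
  qed
  moreover have "finite (\<Union>(m, \<chi>)\<in>M. \<Union>a<m. \<Union>b<m. \<Union>e\<in>{0, 1}. S m \<chi> a b e)"
    using assms fin unfolding closed_under_derivation_def by auto
  ultimately show ?thesis by (rule finite_subset)
qed

text \<open>A power of the substitution fixing the renamed word is carried back to the letters 0 and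
  1. Both codes occur in each image under that power, whence the lower bound on lengths.\<close>

lemma coded_fixed_fixing_morphism:
  assumes "closed_under_derivation M" "coded_fixed M x"
  obtains \<psi> where "\<And>c. c < 2 \<Longrightarrow> set (\<psi> c) \<subseteq> {..<2}" "\<And>c. c < 2 \<Longrightarrow> 2 \<le> length (\<psi> c)"
    "affine_image [] \<psi> x x"
proof -
  obtain m \<chi> a b where 1: "(m, \<chi>) \<in> M" "a \<noteq> b" "a < m" "b < m" "fixed_point m \<chi> (\<lambda>k. recode a b (x k))"
    using assms(2) by (rule coded_fixedE)
  define y where "y = (\<lambda>k. recode a b (x k))"
  have "primitive_morph m \<chi>"
    using assms 1(1) unfolding closed_under_derivation_def primitive_substitution_def by auto
  then obtain X where X: "affine_image [] X y y" "\<And>c d. c < m \<Longrightarrow> d < m \<Longrightarrow> d \<in> set (X c)"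
    using primitive_fixed_power[of m \<chi> y] 1(5) y_def by metis
  \<comment> \<open>The renamed word contains only a and b, so the value 1 on all further letters is
    a mere default.\<close>
  define dec where "dec e = (if e = a then 0 else 1 :: nat)" for e
  define \<psi> where "\<psi> c = map dec (X (recode a b c))" for c
  have x01: "x k \<in> {0, 1}" for k using assms(2) unfolding coded_fixed_def by blast
  have dec: "(\<lambda>k. dec (y k)) = x"
  proof
    fix k show "dec (y k) = x k" using 1(2) x01[of k] by (auto simp: dec_def y_def recode_def)
  qed
  have "affine_image [] \<psi> x x" unfolding affine_image_def
  proof (intro allI impI)
    fix v assume "starts_with x v"
    then have "starts_with y (map (recode a b) v)" unfolding y_def by (rule starts_with_map)
    then have "starts_with y (morph X (map (recode a b) v))" using affine_imageD[OF X(1)] by simp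
    then have "starts_with x (map dec (morph X (map (recode a b) v)))" using starts_with_map dec by metis
    moreover have "map dec (morph X (map (recode a b) v)) = morph \<psi> v" by (induction v) (auto simp: \<psi>_def)
    ultimately show "starts_with x ([] @ morph \<psi> v)" by simp
  qed
  moreover have "2 \<le> length (\<psi> c)" for c
  proof -
    have "recode a b c < m" using 1 by (simp add: recode_def)
    then show ?thesis using length_ge_2[of a _ b] X(2) 1 by (simp add: \<psi>_def)
  qed
  moreover have "set (\<psi> c) \<subseteq> {..<2}" for c by (auto simp: \<psi>_def dec_def)
  ultimately show ?thesis using that by blast
qed

section \<open>Derivation with respect to a single letter\<close>

lemma enumerate_range:
  fixes P :: "nat \<Rightarrow> nat"
  assumes "strict_mono P"
  shows "enumerate (range P) k = P k"
proof (induction k)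
  case 0
  show ?case unfolding enumerate_0
    by (rule Least_equality) (auto simp: strict_mono_less_eq[OF assms])
next
  case (Suc k)
  have "infinite (range P)" using assms strict_mono_imp_inj_on finite_imageD infinite_UNIV_nat by blast
  then have "enumerate (range P) (Suc k) = (LEAST s. s \<in> range P \<and> enumerate (range P) k < s)"
    by (rule enumerate_Suc'')
  also have "\<dots> = P (Suc k)" unfolding Suc
    by (rule Least_equality) (auto simp: strict_mono_less_eq[OF assms] strict_mono_less[OF assms])
  finally show ?case .
qed

lemma subw_eq_pref: "subw u i m = pref (shift i u) m"
  unfolding subw_def pref_def by (rule nth_equalityI) auto

text \<open>Each block \<open>r (x k)\<close> starts with a and contains no second a, and
  \<open>p\<close> contains none. The occurrences of a are thus the block starts, and the blocks are
  the successive return words.\<close>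

lemma derived_by_letter:
  assumes ab: "a \<noteq> b" and r: "\<And>k. r (x k) \<in> {[a], [a, b]}"
    and img: "affine_image p r x y" and p: "a \<notin> set p"
  shows "ret_seq y [a] k = r (x k)" and "r (x k) \<in> return_words y [a]"
proof -
  define P where "P k = length p + length (morph r (pref x k))" for k
  have PS: "P (Suc k) = P k + length (r (x k))" for k by (simp add: P_def pref_Suc)
  have lr: "0 < length (r (x k))" for k using r[of k] by auto
  have sm: "strict_mono P" unfolding strict_mono_Suc_iff using PS lr by simp
  have blk: "starts_with (shift (P k) y) (r (x k))" for k
    using affine_image_letter[OF img] by (simp add: P_def)
  have yP: "y (P k) = a" for k using starts_with_nth[OF blk, of 0 k] r[of k] by auto
  have "j \<in> range P" if "y j = a" for j
  proof -
    have "starts_with y p" using affine_imageD[OF img, of "[]"] by (simp add: starts_with_def)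
    then have "P 0 \<le> j" using starts_with_nth[of y p j] that p nth_mem[of j p]
      by (force simp: P_def not_less[symmetric])
    then obtain k where k: "P k \<le> j" "j < P (Suc k)"
      using ex_between[of P j] strict_mono_imp_increasing[OF sm] by blast
    have "j = P k"
    proof (rule ccontr)
      assume "j \<noteq> P k"
      then have "j = P k + 1" "r (x k) = [a, b]" using k PS[of k] r[of k] by auto
      then show False using starts_with_nth[OF blk, of 1 k] that ab by simp
    qed
    then show ?thesis by simp
  qed
  then have "{j. y j = a} = range P" using yP by auto
  then have occs: "occs y [a] = range P" by (simp add: occs_def subw_def)
  have pos: "occ_pos y [a] k = P k" for k unfolding occ_pos_def occs by (rule enumerate_range[OF sm])
  show "ret_seq y [a] k = r (x k)"
    using blk[of k] unfolding ret_seq_def pos PS subw_eq_pref starts_with_def by simp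
  have "starts_with (shift (P k) y) (r (x k) @ [a])"
    using blk[of k] starts_with_snoc[of "shift (P k) y" "r (x k)"] yP[of "Suc k"] by (simp add: PS)
  then have "factor (r (x k) @ [a]) y"
    unfolding factor_def subw_eq_pref starts_with_def by metis
  moreover have "occs_fin [a] (r (x k) @ [a]) = {0, length (r (x k))}"
  proof (cases "r (x k) = [a]")
    case True
    have "i \<in> occs_fin [a] [a, a] \<longleftrightarrow> i \<in> {0, 1}" for i
      by (cases "i = 0"; cases "i = 1"; simp add: occs_fin_def)
    then show ?thesis using True by (simp add: set_eq_iff)
  next
    case False
    then have 2: "r (x k) = [a, b]" using r[of k] by auto
    have "i \<in> occs_fin [a] [a, b, a] \<longleftrightarrow> i \<in> {0, 2}" for i
      using ab by (cases "i = 0"; cases "i = 1"; cases "i = 2"; simp add: occs_fin_def)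
    then show ?thesis using 2 by (simp add: set_eq_iff numeral_2_eq_2)
  qed
  moreover have "r (x k) \<noteq> []" using lr[of k] by simp
  ultimately show "r (x k) \<in> return_words y [a]" unfolding return_words_def by simp
qed

text \<open>All blocks of the standard morphism start with one letter, 0 for \<open>Gb\<close> and 1
  for \<open>Gbeta\<close>. Deriving the renamed word with respect to the code of this letter yields
  x' up to renaming, and closedness supplies an element of M that fixes it.\<close>

lemma coded_fixed_desubstitute:
  assumes closed: "closed_under_derivation M" and cf: "coded_fixed M x"
    and img: "affine_image p (phi_gen (standard g)) x' x" and range': "range x' = {0, 1}"
    and p: "p = [] \<or> p = [if g \<in> {Ga, Gb} then 1 else 0]"
  shows "coded_fixed M x'"
proof -
  obtain m \<chi> a b where 1: "(m, \<chi>) \<in> M" "a \<noteq> b" "a < m" "b < m" "fixed_point m \<chi> (\<lambda>k. recode a b (x k))"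
    using cf by (rule coded_fixedE)
  define y where "y = (\<lambda>k. recode a b (x k))"
  define r where "r c = map (recode a b) (phi_gen (standard g) c)" for c
  define l where "l = (if g \<in> {Ga, Gb} then a else b)"
  define l' where "l' = (if g \<in> {Ga, Gb} then b else a)"
  have x': "x' k \<in> {0, 1}" for k using range' by blast
  have img': "affine_image (map (recode a b) p) r x' y" unfolding affine_image_def
  proof (intro allI impI)
    fix v assume "starts_with x' v"
    then have "starts_with x (p @ morph (phi_gen (standard g)) v)" by (rule affine_imageD[OF img])
    then have "starts_with y (map (recode a b) (p @ morph (phi_gen (standard g)) v))"
      unfolding y_def by (rule starts_with_map)
    then show "starts_with y (map (recode a b) p @ morph r v)" unfolding r_def by (simp add: morph_map)
  qed
  have r: "r (x' k) \<in> {[l], [l, l']}" for k using x'[of k]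
    by (cases g) (auto simp: r_def l_def l'_def recode_def)
  have ll: "l \<noteq> l'" using 1 by (auto simp: l_def l'_def)
  have lp: "l \<notin> set (map (recode a b) p)" using p 1(2) by (auto simp: l_def recode_def)
  note ret = derived_by_letter[OF ll r img' lp]
  have rne: "r 0 \<noteq> r 1" using 1(2) by (cases g) (auto simp: r_def recode_def)
  have "0 \<in> range x'" "1 \<in> range x'" using range' by auto
  then obtain k0 k1 where k: "x' k0 = 0" "x' k1 = 1" by auto
  have "factor [l] y"
  proof -
    have "0 \<in> range x" "1 \<in> range x" using cf by (auto simp: coded_fixed_def)
    then obtain i j where "x i = 0" "x j = 1" by auto
    then have "subw y i 1 = [a]" "subw y j 1 = [b]" by (simp_all add: subw_def y_def recode_def)
    then show ?thesis unfolding factor_def l_def by auto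
  qed
  then obtain m2 \<chi>2 f where 2: "(m2, \<chi>2) \<in> M" and inj: "inj_on f (return_words y [l])"
    and fp: "fixed_point m2 \<chi>2 (\<lambda>k. f (ret_seq y [l] k))"
    using closed 1(1,5) unfolding closed_under_derivation_def derived_word_fixed_by_def y_def by blast
  have "f (r 0) \<noteq> f (r 1)" using inj ret(2)[of k0] ret(2)[of k1] k rne by (metis inj_onD)
  moreover have "(\<lambda>k. f (ret_seq y [l] k)) = (\<lambda>k. recode (f (r 0)) (f (r 1)) (x' k))"
  proof
    fix k show "f (ret_seq y [l] k) = recode (f (r 0)) (f (r 1)) (x' k)"
      using ret(1)[of k] x'[of k] by (auto simp: recode_def)
  qed
  ultimately show ?thesis unfolding coded_fixed_def using range' 2 fp by auto
qed

section \<open>Desubstitution of shifted words\<close>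

text \<open>The word that conjugates \<open>phi_gen g\<close> to its standard representative; it is
  split off when a prefix is cut.\<close>

fun trailer :: "gen \<Rightarrow> nat list" where
  "trailer Ga = [0]" | "trailer Galpha = [1]" | "trailer Gb = []" | "trailer Gbeta = []"

lemma phi_gen_standard_conj:
  "set v \<subseteq> {..<2} \<Longrightarrow>
     morph (phi_gen (standard g)) v @ trailer g = trailer g @ morph (phi_gen g) v"
  by (induction v) (cases g; auto simp: less_2_cases_iff)+

lemma phi_gen_nonempty: "phi_gen g c \<noteq> []"
  by (cases g) auto

lemma mem_phi: "c \<in> set (phi w c)"
proof (induction w)
  case (Cons g w)
  have "c \<in> set (phi_gen g c)" by (cases g) auto
  then show ?case using Cons by (auto simp: set_morph)
qed simp

lemma phi_nonempty: "phi w c \<noteq> []"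
  using mem_phi[of c w] by auto

text \<open>Take the shortest prefix of u' whose image has at least i letters plus the trailer, and
  remove the trailer from that image to get B. Conjugation shows that u is B followed by the
  standard image of the rest of u'. As blocks have at most two letters, B extends beyond i by at
  most one letter, which is p.\<close>

lemma desubstitute_shift:
  assumes img: "affine_image [] (phi_gen g) u' u" and bin: "\<And>k. u' k < 2"
  obtains i' p where "affine_image p (phi_gen (standard g)) (shift i' u') (shift i u)"
    "p = [] \<or> p = [if g \<in> {Ga, Gb} then 1 else 0]"
    "p = [] \<Longrightarrow> morph (phi_gen g) (pref u' i') = pref u i @ trailer g"
proof -
  let ?\<phi> = "morph (phi_gen g)"
  define t where "t = length (trailer g)"
  define i' where "i' = (LEAST j. i + t \<le> length (?\<phi> (pref u' j)))"
  have "j \<le> length (?\<phi> (pref u' j))" for j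
    using length_morph_ge[of "pref u' j" 1 "phi_gen g"] phi_gen_nonempty by (auto simp: Suc_le_eq)
  then have i': "i + t \<le> length (?\<phi> (pref u' i'))" unfolding i'_def by (rule LeastI)
  obtain B where B: "?\<phi> (pref u' i') = B @ trailer g"
    and Bp: "length B \<noteq> i \<Longrightarrow> drop i B = [if g \<in> {Ga, Gb} then 1 else 0]"
  proof (cases i')
    case 0
    then have "i = 0" "t = 0" using i' by auto
    then show ?thesis using that[of "[]"] 0 by (auto simp: t_def)
  next
    case (Suc j)
    define C where "C = ?\<phi> (pref u' j)"
    have C: "length C < i + t" 
      using not_less_Least[of j "\<lambda>j. i + t \<le> length (?\<phi> (pref u' j))"] Suc unfolding C_def i'_def by simp
    have BC: "?\<phi> (pref u' i') = C @ phi_gen g (u' j)" by (simp add: Suc pref_Suc C_def)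
    define c where "c = u' j"
    have c: "c = 0 \<or> c = 1" using bin[of j] by (auto simp: c_def)
    \<comment> \<open>The nested conditional is \<open>phi_gen g c\<close> without its trailer; the
      first branch covers the letter with a two-letter image.\<close>
    define B where "B = C @ (if (c = 0) = (g \<in> {Galpha, Gbeta}) then (if g = Ga then [1] else if g = Gb then [0, 1] else if g = Galpha then [0] else [1, 0]) else (if g = Gb then [0] else if g = Gbeta then [1] else []))"
    have "?\<phi> (pref u' i') = B @ trailer g"
      unfolding BC B_def c_def[symmetric] using c by (cases g) auto
    moreover have "drop i B = [if g \<in> {Ga, Gb} then 1 else 0]" if "length B \<noteq> i"
    proof -
      have "i < length B" using i' calculation that by (simp add: t_def)
      \<comment> \<open>By minimality of \<open>i'\<close> the cut falls within the last block,
        which must then have two letters; the leftover letter is c itself.\<close>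
      then have i1: "g \<in> {Ga, Galpha} \<Longrightarrow> i = length C" and i2: "g \<in> {Gb, Gbeta} \<Longrightarrow> i = Suc (length C)"
        and two: "(c = 0) = (g \<in> {Galpha, Gbeta})"
        using C by (cases g; auto simp: B_def t_def split: if_splits)+
      show ?thesis using i1 i2 two by (cases g) (auto simp: B_def)
    qed
    ultimately show ?thesis using that by blast
  qed
  define p where "p = drop i B"
  have "i \<le> length B" using i' B by (simp add: t_def)
  have swB: "starts_with u (B @ morph (phi_gen (standard g)) v)" if "starts_with (shift i' u') v" for v
  proof -
    have "set v \<subseteq> {..<2}" using set_starts_with[OF that, of 2] bin by simp
    have "starts_with u' (pref u' i' @ v)" using that by (simp add: starts_with_append_iff)
    then have "starts_with u (?\<phi> (pref u' i' @ v))" using affine_imageD[OF img] by fastforce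
    then have "starts_with u (B @ trailer g @ ?\<phi> v)" using B by simp
    then have "starts_with u ((B @ morph (phi_gen (standard g)) v) @ trailer g)"
      using phi_gen_standard_conj[OF \<open>set v \<subseteq> {..<2}\<close>, of g] by simp
    then show ?thesis by (rule starts_with_appendD)
  qed
  have "starts_with u B" using swB[of "[]"] by (simp add: starts_with_def)
  then have Bi: "B = pref u i @ p"
    using starts_with_extend[OF starts_with_pref, of u B i] \<open>i \<le> length B\<close> by (simp add: p_def)
  have 1: "affine_image p (phi_gen (standard g)) (shift i' u') (shift i u)" unfolding affine_image_def
  proof (intro allI impI)
    fix v assume "starts_with (shift i' u') v"
    then have "starts_with u (pref u i @ (p @ morph (phi_gen (standard g)) v))" using swB Bi by simp
    then show "starts_with (shift i u) (p @ morph (phi_gen (standard g)) v)"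
      unfolding starts_with_append_iff[of _ "pref u i"] by simp
  qed
  have 2: "p = [] \<or> p = [if g \<in> {Ga, Gb} then 1 else 0]"
  proof (cases "length B = i")
    case True then show ?thesis by (simp add: p_def)
  qed (use Bp p_def in blast)
  show ?thesis using that[OF 1 2] B Bi by simp
qed

section \<open>Letter counts of the cut-off prefixes\<close>

text \<open>\<open>chain w s' s\<close> relates the prefixes cut off before and after desubstituting along \<open>w\<close>
  when no offset \<open>p\<close> arises.\<close>

fun chain :: "gen list \<Rightarrow> nat list \<Rightarrow> nat list \<Rightarrow> bool" where
  "chain [] s' s \<longleftrightarrow> s' = s"
| "chain (g # w) s' s \<longleftrightarrow> (\<exists>t. morph (phi_gen g) t = s @ trailer g \<and> chain w s' t)"

lemma chain_append: "chain w1 s' s \<Longrightarrow> chain w2 s'' s' \<Longrightarrow> chain (w1 @ w2) s'' s"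
  by (induction w1 arbitrary: s) auto

lemma chain_step_counts:
  assumes "morph (phi_gen g) t = s @ trailer g" "set t \<subseteq> {..<2}"
  shows "count_list t 0 + count_list t 1 * count_list (phi_gen g 1) 0
      = count_list s 0 + count_list (trailer g) 0" (is ?A)
    and "count_list t 0 * count_list (phi_gen g 0) 1 + count_list t 1
      = count_list s 1 + count_list (trailer g) 1" (is ?B)
    and "set s \<subseteq> {..<2}"
proof -
  have "count_list (morph (phi_gen g) t) d = count_list s d + count_list (trailer g) d" for d
    using assms(1) by simp
  from this[of 0] this[of 1] show ?A ?B
    unfolding count_morph[OF assms(2)] by (cases g; simp)+
  have "set (s @ trailer g) \<subseteq> {..<2}"
    unfolding assms(1)[symmetric] by (rule set_morph_binary[OF set_phi_gen assms(2)])
  then show "set s \<subseteq> {..<2}" by simp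
qed

text \<open>When both letters occur, a step with b or \<beta> strictly lengthens the word. A step
  with a or \<alpha> gains at least one letter before the one-letter trailer is removed, so it never
  shortens it.\<close>

lemma chain_both_letters:
  assumes "chain w s' s" "set s' \<subseteq> {..<2}" "1 \<le> count_list s' 0" "1 \<le> count_list s' 1"
  shows "set s \<subseteq> {..<2} \<and> 1 \<le> count_list s 0 \<and> 1 \<le> count_list s 1 \<and>
    count_list s' 0 + count_list s' 1 \<le> count_list s 0 + count_list s 1 \<and>
    (count_list s' 0 + count_list s' 1 = count_list s 0 + count_list s 1 \<longrightarrow> set w \<subseteq> {Ga, Galpha})"
  using assms
proof (induction w arbitrary: s)
  case (Cons g w)
  then obtain t where t: "morph (phi_gen g) t = s @ trailer g" "chain w s' t" by auto
  note IH = Cons.IH[OF t(2) Cons.prems(2-)]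
  note st = chain_step_counts[OF t(1) conjunct1[OF IH]]
  show ?case using IH st by (cases g) auto
qed auto

text \<open>Consider a step from 0^n with n at least 1: b preserves n, a lowers it by one, \<alpha>
  avoids producing both letters only for n = 1, and \<beta> always produces both. Powers of 1 behave
  symmetrically, and the empty word admits only b and \<beta>.\<close>

lemma chain_one_letter:
  assumes "chain w s' s" "set s' \<subseteq> {..<2}" "count_list s 0 = 0 \<or> count_list s 1 = 0"
  shows "set s \<subseteq> {..<2} \<and>
    (count_list s' 0 = 0 \<and> count_list s' 1 = 0 \<and> count_list s 0 = 0 \<and> count_list s 1 = 0 \<and>
       set w \<subseteq> {Gb, Gbeta}
     \<or> 1 \<le> count_list s' 0 \<and> count_list s' 1 = 0 \<and> count_list s 0 \<le> count_list s' 0 \<and>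
       count_list s 1 = 0 \<and> (count_list s 0 = count_list s' 0 \<longrightarrow> set w \<subseteq> {Gb, Galpha})
     \<or> 1 \<le> count_list s' 1 \<and> count_list s' 0 = 0 \<and> count_list s 1 \<le> count_list s' 1 \<and>
       count_list s 0 = 0 \<and> (count_list s 1 = count_list s' 1 \<longrightarrow> set w \<subseteq> {Gbeta, Ga}))"
  using assms
proof (induction w arbitrary: s)
  case (Cons g w)
  then obtain t where t: "morph (phi_gen g) t = s @ trailer g" "chain w s' t" by auto
  have bin: "chain w s' s \<Longrightarrow> set s \<subseteq> {..<2}" for s
  proof (induction w arbitrary: s)
    case (Cons g w)
    then obtain t where "morph (phi_gen g) t = s @ trailer g" "chain w s' t" by auto
    then show ?case using Cons.IH chain_step_counts(3) by blast
  qed (use Cons.prems in auto)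
  note st = chain_step_counts[OF t(1) bin[OF t(2)]]
  have "count_list t 0 = 0 \<or> count_list t 1 = 0" using Cons.prems(3) st by (cases g) auto
  note IH = Cons.IH[OF t(2) Cons.prems(2) this]
  show ?case using IH st Cons.prems(3) by (cases g) auto
next
  case Nil
  then show ?case by auto
qed

text \<open>Around a cycle the counts cannot change, so one of the equality cases applies to every
  generator.\<close>

lemma chain_cycle:
  assumes "chain w s s" "set s \<subseteq> {..<2}"
  shows "card (set w) \<le> 2"
proof -
  have "set w \<subseteq> {Ga, Galpha} \<or> set w \<subseteq> {Gb, Gbeta} \<or> set w \<subseteq> {Gb, Galpha} \<or> set w \<subseteq> {Gbeta, Ga}"
  proof (cases "count_list s 0 = 0 \<or> count_list s 1 = 0")
    case True
    then show ?thesis using chain_one_letter[OF assms True] by blast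
  next
    case False
    then show ?thesis using chain_both_letters[OF assms] by simp
  qed
  moreover have "card (set w) \<le> 2" if "set w \<subseteq> {g, h}" for g h
    using card_mono[OF _ that] card_insert_le_m1[of 2 "{h}" g] by simp
  ultimately show ?thesis by blast
qed

section \<open>Descent through the whole word w\<close>

definition recurrent_binary :: "(nat \<Rightarrow> nat) \<Rightarrow> bool" where
  "recurrent_binary u \<longleftrightarrow> (\<forall>k. u k < 2) \<and> (\<forall>N. \<forall>d<2. \<exists>k\<ge>N. u k = d)"

lemma recurrent_binary_range:
  assumes "recurrent_binary u"
  shows "range (shift i u) = {0, 1}"
proof
  have "u k < 2" for k using assms by (simp only: recurrent_binary_def)
  then have "shift i u k \<in> {0, 1}" for k using less_2_cases[of "u (i + k)"] by auto
  then show "range (shift i u) \<subseteq> {0, 1}" by (rule image_subsetI)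
  have "d \<in> range (shift i u)" if "d < 2" for d
  proof -
    have "\<exists>k\<ge>i. u k = d" using assms that by (simp only: recurrent_binary_def)
    then obtain k where "i \<le> k" "u k = d" by blast
    then have "shift i u (k - i) = d" by simp
    then show ?thesis by (metis rangeI)
  qed
  from this[of 0] this[of 1] show "{0, 1} \<subseteq> range (shift i u)" by simp
qed

lemma recurrent_binary_image:
  assumes img: "affine_image [] (phi w) u' u" and u': "recurrent_binary u'"
  shows "recurrent_binary u"
proof -
  have "\<exists>k\<ge>N. u k = d" if d: "d < 2" for N d
  proof -
    obtain k where "k \<ge> N" "u' k = d" using u' d unfolding recurrent_binary_def by blast
    then show ?thesis using affine_image_recurrent[OF img _ _ _ mem_phi] phi_nonempty by blast
  qed
  moreover have "u k < 2" for k
  proof -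
    define v where "v = morph (phi w) (pref u' (Suc k))"
    have "starts_with u v" using affine_imageD[OF img] by (simp add: v_def)
    have "1 * Suc k \<le> length v"
      using length_morph_ge[of "pref u' (Suc k)" 1 "phi w"] phi_nonempty by (auto simp: v_def Suc_le_eq)
    then have "u k = v ! k" "v ! k \<in> set v" using starts_with_nth[OF \<open>starts_with u v\<close>] by auto
    moreover have "set v \<subseteq> {..<2}" unfolding v_def
      by (rule set_morph_binary[OF set_phi]) (use u' in \<open>auto simp: recurrent_binary_def set_pref\<close>)
    ultimately show ?thesis by auto
  qed
  ultimately show ?thesis by (simp add: recurrent_binary_def)
qed

text \<open>The prefixes are related only when the offset is empty. This composes, because the
  offset of a composite is empty only if those of both parts are.\<close>

definition descends ::
    "gen list \<Rightarrow> (nat \<Rightarrow> nat) \<Rightarrow> nat \<Rightarrow> (nat \<Rightarrow> nat) \<Rightarrow> nat \<Rightarrow> bool" where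
  "descends w u i u' i' \<longleftrightarrow>
     (\<exists>p. affine_image p (phi (map standard w)) (shift i' u') (shift i u) \<and>
       (p = [] \<longrightarrow> chain w (pref u' i') (pref u i)))"

lemma descends_append:
  assumes "descends w1 u i u' i'" "descends w2 u' i' u'' i''"
  shows "descends (w1 @ w2) u i u'' i''"
proof -
  obtain p where p: "affine_image p (phi (map standard w1)) (shift i' u') (shift i u)"
    "p = [] \<Longrightarrow> chain w1 (pref u' i') (pref u i)" using assms(1) unfolding descends_def by blast
  obtain q where q: "affine_image q (phi (map standard w2)) (shift i'' u'') (shift i' u')"
    "q = [] \<Longrightarrow> chain w2 (pref u'' i'') (pref u' i')" using assms(2) unfolding descends_def by blast
  let ?p = "p @ morph (phi (map standard w1)) q"
  have "affine_image ?p (phi (map standard (w1 @ w2))) (shift i'' u'') (shift i u)"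
    using affine_image_comp[OF p(1) q(1)] by (simp add: phi_append[abs_def])
  moreover have "chain (w1 @ w2) (pref u'' i'') (pref u i)" if "?p = []"
  proof -
    have "q = []" using that phi_nonempty by (cases q) auto
    then show ?thesis using chain_append p(2) q(2) that by simp
  qed
  ultimately show ?thesis unfolding descends_def by blast
qed

text \<open>With u1 the image of u' under the remaining generators, u is the image of u1 under the
  first one. Hence one generator is desubstituted at a time, each step being a derivation by a
  letter.\<close>

lemma descend:
  assumes "closed_under_derivation M" "affine_image [] (phi w) u' u" "recurrent_binary u'"
    "coded_fixed M (shift i u)" "w \<noteq> []"
  shows "\<exists>i'. descends w u i u' i' \<and> coded_fixed M (shift i' u')"
  using assms
proof (induction w arbitrary: u i)
  case (Cons g w)
  obtain u1 where u1: "affine_image [] (phi w) u' u1" using ex_image_word[of "phi w" u'] phi_nonempty by blast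
  then have rec: "recurrent_binary u1" using recurrent_binary_image Cons.prems(3) by blast
  have "starts_with u (morph (phi_gen g) (pref u1 N))" for N
  proof -
    define v where "v = morph (phi w) (pref u' N)"
    have "starts_with u1 v" using affine_imageD[OF u1] by (simp add: v_def)
    moreover have "N \<le> length v"
      using length_morph_ge[of "pref u' N" 1 "phi w"] phi_nonempty by (auto simp: v_def Suc_le_eq)
    ultimately obtain v' where v': "v = pref u1 N @ v'"
      using starts_with_extend[OF starts_with_pref, of u1 v N] by auto
    have "starts_with u (morph (phi_gen g) v)"
      using affine_imageD[OF Cons.prems(2) starts_with_pref, of N] by (simp add: v_def morph_morph)
    then show ?thesis using v' starts_with_appendD by simp
  qed
  then have img: "affine_image [] (phi_gen g) u1 u" unfolding affine_image_iff_pref by simp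
  have u1b: "u1 k < 2" for k using rec by (simp add: recurrent_binary_def)
  obtain i1 p where s: "affine_image p (phi_gen (standard g)) (shift i1 u1) (shift i u)"
    "p = [] \<or> p = [if g \<in> {Ga, Gb} then 1 else 0]"
    "p = [] \<Longrightarrow> morph (phi_gen g) (pref u1 i1) = pref u i @ trailer g"
    using desubstitute_shift[OF img u1b, where i = i] by metis
  have cf: "coded_fixed M (shift i1 u1)"
    using coded_fixed_desubstitute[OF Cons.prems(1,4) s(1) recurrent_binary_range[OF rec] s(2)] .
  have "phi [standard g] = phi_gen (standard g)" by auto
  then have d: "descends [g] u i u1 i1" unfolding descends_def using s(1,3) by auto
  show ?case
  proof (cases "w = []")
    case True
    then have "morph (phi w) v = v" for v by (induction v) auto
    then have "u1 = u'" using u1 unfolding affine_image_def starts_with_def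
      by (metis append_Nil ext lessI length_pref nth_pref)
    then show ?thesis using d cf True by blast
  next
    case False
    then obtain i' where "descends w u1 i1 u' i'" "coded_fixed M (shift i' u')"
      using Cons.IH[OF Cons.prems(1) u1 Cons.prems(3) cf] by blast
    then show ?thesis using descends_append[OF d] by (metis append_Cons append_Nil)
  qed
qed simp

section \<open>Pigeonhole over repeated passes through w\<close>

theorem theorem20:
  fixes w :: "gen list"
  assumes "card (set w) \<ge> 3"
  shows "\<not> closeable_under_derivation 2 (phi w)"
proof
  assume "closeable_under_derivation 2 (phi w)"
  then obtain M where prim: "primitive_morph 2 (phi w)" "is_substitution 2 (phi w)"
    and M: "closed_under_derivation M" "(2, phi w) \<in> M"
    unfolding closeable_under_derivation_def primitive_substitution_def by blast
  obtain u where u: "fixed_point 2 (phi w) u" using ex_fixed_point[OF prim(2)] by blast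
  then have img: "affine_image [] (phi w) u u" and ub: "\<And>k. u k < 2" by (auto simp: fixed_point_iff)
  have rec: "recurrent_binary u"
    unfolding recurrent_binary_def using ub primitive_recurrent[OF prim(1) u] by blast
  have "(\<lambda>k. recode 0 1 (shift 0 u k)) = u"
  proof
    fix k show "recode 0 1 (shift 0 u k) = u k" using ub[of k] by (auto simp: recode_def)
  qed
  then have "\<exists>a b. a \<noteq> b \<and> fixed_point 2 (phi w) (\<lambda>k. recode a b (shift 0 u k))"
    using u by (metis zero_neq_one)
  then have start: "coded_fixed M (shift 0 u)"
    unfolding coded_fixed_def
    by (intro conjI recurrent_binary_range[OF rec] bexI[OF _ M(2)]) (simp only: prod.case)
  have "w \<noteq> []" using assms by auto
  then have "\<exists>i'. coded_fixed M (shift i' u) \<and> descends w u i u i'" if "coded_fixed M (shift i u)" for i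
    using descend[OF M(1) img rec that] by blast
  then obtain i where i: "\<And>k. coded_fixed M (shift (i k) u)" "\<And>k. descends w u (i k) u (i (Suc k))"
    using dependent_nat_choice[of "\<lambda>_ i. coded_fixed M (shift i u)" "\<lambda>_ i i'. descends w u i u i'"] start
    by metis
  have comp: "\<exists>W. set W = set w \<and> descends W u (i k) u (i (k + Suc n))" for k n
  proof (induction n)
    case 0 then show ?case using i(2)[of k] by auto
  next
    case (Suc n)
    then obtain W where "set W = set w" "descends W u (i k) u (i (k + Suc n))" by blast
    then have "descends (W @ w) u (i k) u (i (k + Suc (Suc n)))"
      using descends_append i(2)[of "k + Suc n"] by simp
    then show ?case using \<open>set W = set w\<close> by (intro exI[of _ "W @ w"]) simp
  qed
  \<comment> \<open>All tails reached are coded by fixed points of M, so only finitely many are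
    distinct and two passes arrive at the same tail.\<close>
  have "finite (range (\<lambda>k. shift (i k) u))"
    by (rule finite_subset[OF _ finite_coded_fixed[OF M(1)]]) (use i(1) in auto)
  then have "\<not> inj (\<lambda>k. shift (i k) u)" using finite_imageD infinite_UNIV_nat by blast
  then obtain k1 k2 where "k1 < k2" and eq: "shift (i k1) u = shift (i k2) u"
    unfolding inj_def by (metis linorder_neqE_nat)
  then obtain W where W: "set W = set w" "descends W u (i k1) u (i k2)"
    using comp less_iff_Suc_add by (metis add_Suc_right)
  define x where "x = shift (i k1) u"
  obtain p where p: "affine_image p (phi (map standard W)) x x"
    "p = [] \<Longrightarrow> chain W (pref u (i k2)) (pref u (i k1))"
    using W(2) eq unfolding descends_def x_def by auto
  \<comment> \<open>Three distinct letters fit neither into {a, b} nor into {\<alpha>, \<beta>}, so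
    both standard generators occur.\<close>
  have "set (map standard W) = {Gb, Gbeta}"
  proof -
    have "\<not> set w \<subseteq> {g, h}" for g h
      using assms card_mono[of "{g, h}" "set w"] card_insert_le_m1[of 2 "{h}" g] by fastforce
    then obtain g1 g2 where g: "g1 \<in> set w" "g1 \<notin> {Ga, Gb}" "g2 \<in> set w" "g2 \<notin> {Galpha, Gbeta}"
      by (meson subsetI)
    have "standard g1 = Gbeta" using g(2) by (cases g1) simp_all
    moreover have "standard g2 = Gb" using g(4) by (cases g2) simp_all
    ultimately have "{Gb, Gbeta} \<subseteq> standard ` set w" using g by (metis empty_subsetI imageI insert_subset)
    moreover have "standard g \<in> {Gb, Gbeta}" for g by (cases g) auto
    then have "standard ` set w \<subseteq> {Gb, Gbeta}" by (rule image_subsetI)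
    ultimately have "standard ` set w = {Gb, Gbeta}" by (intro subset_antisym)
    then show ?thesis using W(1) by simp
  qed
  then interpret renormalised_word p "map standard W" x
    using p(1) ub by unfold_locales (auto simp: x_def)
  have cf: "coded_fixed M x" unfolding x_def by (rule i(1))
  obtain \<psi> where \<psi>: "\<And>c. c < 2 \<Longrightarrow> set (\<psi> c) \<subseteq> {..<2}" "\<And>c. c < 2 \<Longrightarrow> 2 \<le> length (\<psi> c)"
    "affine_image [] \<psi> x x" using coded_fixed_fixing_morphism[OF M(1) cf] by metis
  have "0 \<in> range x" "1 \<in> range x" using cf by (auto simp: coded_fixed_def)
  then obtain j0 j1 where "x j0 = 0" "x j1 = 1" by auto
  then have "p = []" using fixed_imp_no_offset[OF \<psi>] by blast
  \<comment> \<open>Aperiodicity turns equality of tails into equality of positions, so with an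
    empty offset the cut-off prefix is carried to itself.\<close>
  moreover have "i k1 = i k2" using shift_inj eq x_def by metis
  ultimately have "chain W (pref u (i k1)) (pref u (i k1))" using p(2) by simp
  then have "card (set W) \<le> 2" by (rule chain_cycle) (use ub in \<open>auto simp: set_pref\<close>)
  then show False using assms W(1) by simp
qed

end
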